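(* Let $H$ be a finite connected graph (multiple edges allowed, no loops) with vertices $v_1,\dots,v_m$, and for each $i=1,\dots,m$ fix integers $1\le s_{i,1}<s_{i,2}<\dots<s_{i,k_i}$ ($k_i\ge 0$) such that $\gcd(s_{i,p},\ i=1,\dots,m,\ p=1,\dots,k_i)=1$. For every positive integer $n$ such that all $s_{i,j}\le\frac n2$, let $\tau(n)$ be the number of spanning trees of the circulant foliation $H_n=H_n(G_1,\dots,G_m)$ with fibers $G_i=C_n(s_{i,1},\dots,s_{i,k_i})$. Let $Q(w)$ be the associated polynomial defined in the context. Then $$\tau(n)\sim\frac{n}{q}A^n,\qquad n\to\infty,$$ where $q=\sum_{i=1}^m\sum_{j=1}^{k_i}s_{i,j}^2$ and $A=\exp\left(\int_0^1\log|Q(\cos 2\pi t)|\,dt\right)$.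
   Context: The circulant graph $C_n(s_1,\dots,s_k)$, $1\le s_1<\dots<s_k\le n/2$, has $n$ vertices indexed by $\mathbb Z/n$, with vertex $i$ adjacent to $i\pm s_1,\dots,i\pm s_k \pmod n$; if $n$ is even and $s_k=n/2$, the vertices $i$ and $i+s_k$ are joined by two edges. The case $k=0$ is the empty graph on $n$ isolated vertices. Let $a_{i,j}$ be the number of edges between $v_i$ and $v_j$ in $H$ (so $a_{i,i}=0$), $A(H)=(a_{i,j})$ its adjacency matrix, and $d_i=\sum_j a_{i,j}$ the degree of $v_i$. The circulant foliation $H_n=H_n(G_1,\dots,G_m)$ over $H$ with fibers $G_i=C_n(s_{i,1},\dots,s_{i,k_i})$ is the graph with vertex set $\{(k,v_i): k=1,\dots,n,\ i=1,\dots,m\}$ (first coordinate modulo $n$), where for each fixed $k$ and $i\ne j$ the vertices $(k,v_i)$ and $(k,v_j)$ are joined by $a_{i,j}$ edges, for each fixed $i$ the vertices $(k,v_i)$, $k=1,\dots,n$, form the graph $G_i$, i.e. $(k,v_i)$ is adjacent to $(k\pm s_{i,p},v_i)$, $p=1,\dots,k_i$, and there are no other edges. Parallel edges count as distinct edges when counting spanning trees. $Q(w)=\det\left(\mathrm{diag}(w_1,\dots,w_m)-A(H)\right)$ where $w_i=2k_i+d_i-\sum_{p=1}^{k_i}2\,T_{s_{i,p}}(w)$ and $T_k(w)=\cos(k\arccos w)$ is the Chebyshev polynomial of the first kind. $f(n)\sim g(n)$ means $f(n)/g(n)\to1$. *)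

theory Defs
  imports
    "HOL-Analysis.Analysis"
    "HOL-Library.Landau_Symbols"
    "HOL-Computational_Algebra.Polynomial"
    "Jordan_Normal_Form.Determinant"
begin

section \<open>Multigraphs and spanning trees\<close>

text \<open>
  Edges are first-class objects, so parallel edges are distinct elements of the edge set.
  The map \<open>ends\<close> sends an edge to its (unordered) set of end points.
\<close>

record ('v, 'e) multigraph =
  verts :: "'v set"
  edges :: "'e set"
  ends :: "'e \<Rightarrow> 'v set"

text \<open>A finite multigraph without loops: every edge has exactly two end points.\<close>

definition finite_loopfree :: "('v, 'e) multigraph \<Rightarrow> bool" where
  "finite_loopfree G \<longleftrightarrow> finite (verts G) \<and> finite (edges G) \<and>
     (\<forall>e\<in>edges G. ends G e \<subseteq> verts G \<and> card (ends G e) = 2)"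

definition adjacency :: "('v, 'e) multigraph \<Rightarrow> ('v \<times> 'v) set" where
  "adjacency G = {(u, v). \<exists>e\<in>edges G. ends G e = {u, v}}"

definition mg_connected :: "('v, 'e) multigraph \<Rightarrow> bool" where
  "mg_connected G \<longleftrightarrow> verts G \<noteq> {} \<and> (\<forall>u\<in>verts G. \<forall>v\<in>verts G. (u, v) \<in> (adjacency G)\<^sup>*)"

text \<open>
  A cycle with successive vertices \<open>vs\<close> and successive edges \<open>es\<close>; two distinct parallel
  edges form a cycle of length 2.
\<close>

definition mg_cycle :: "('v, 'e) multigraph \<Rightarrow> 'v list \<Rightarrow> 'e list \<Rightarrow> bool" where
  "mg_cycle G vs es \<longleftrightarrow> es \<noteq> [] \<and> length vs = length es \<and> distinct vs \<and> distinct es \<and>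
     set vs \<subseteq> verts G \<and> set es \<subseteq> edges G \<and>
     (\<forall>l<length es. ends G (es ! l) = {vs ! l, vs ! (Suc l mod length es)})"

definition mg_tree :: "('v, 'e) multigraph \<Rightarrow> bool" where
  "mg_tree G \<longleftrightarrow> mg_connected G \<and> (\<nexists>vs es. mg_cycle G vs es)"

text \<open>A spanning tree is identified with its set of edges.\<close>

definition num_spanning_trees :: "('v, 'e) multigraph \<Rightarrow> nat" where
  "num_spanning_trees G = card {F. F \<subseteq> edges G \<and> mg_tree (G\<lparr>edges := F\<rparr>)}"

definition edge_mult :: "('v, 'e) multigraph \<Rightarrow> 'v \<Rightarrow> 'v \<Rightarrow> nat" where
  "edge_mult G u v = card {e \<in> edges G. ends G e = {u, v}}"

definition mg_degree :: "('v, 'e) multigraph \<Rightarrow> 'v \<Rightarrow> nat" where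
  "mg_degree G u = (\<Sum>v\<in>verts G. edge_mult G u v)"


section \<open>Circulant graphs and circulant foliations\<close>

text \<open>
  \<open>circulant n k s\<close> is \<open>C\<^sub>n(s\<^sub>1,\<dots>,s\<^sub>k)\<close>, with the residues modulo \<open>n\<close> represented by
  \<open>0,\<dots>,n-1\<close>.  The edge \<open>(r, p)\<close> joins \<open>r\<close> to \<open>r + s\<^sub>p\<close>.  If \<open>s\<^sub>p < n/2\<close> these are \<open>n\<close> edges
  with different end points; if \<open>s\<^sub>p = n/2\<close> the edges \<open>(r, p)\<close> and \<open>(r + s\<^sub>p, p)\<close> are parallel, so
  that opposite vertices are joined by two edges, as required.
\<close>

definition circulant :: "nat \<Rightarrow> nat \<Rightarrow> (nat \<Rightarrow> nat) \<Rightarrow> (nat, nat \<times> nat) multigraph" where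
  "circulant n k s =
     \<lparr>verts = {..<n}, edges = {..<n} \<times> {1..k}, ends = (\<lambda>(r, p). {r, (r + s p) mod n})\<rparr>"

datatype ('v, 'e, 'f) foliation_edge = Base nat 'e | Fiber 'v 'f

text \<open>
  \<open>Base r e\<close> is the copy of the edge \<open>e\<close> of \<open>H\<close> in the layer \<open>r\<close>; \<open>Fiber v f\<close> is the edge \<open>f\<close> of the
  fiber \<open>G v\<close>, a graph on \<open>{..<n}\<close>, placed over the vertex \<open>v\<close>.
\<close>

definition foliation ::
  "nat \<Rightarrow> ('v, 'e) multigraph \<Rightarrow> ('v \<Rightarrow> (nat, 'f) multigraph)
    \<Rightarrow> (nat \<times> 'v, ('v, 'e, 'f) foliation_edge) multigraph" where
  "foliation n H G =
     \<lparr>verts = {..<n} \<times> verts H,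
      edges = {Base r e |r e. r < n \<and> e \<in> edges H} \<union> {Fiber v f |v f. v \<in> verts H \<and> f \<in> edges (G v)},
      ends = (\<lambda>x. case x of
          Base r e \<Rightarrow> (\<lambda>v. (r, v)) ` ends H e
        | Fiber v f \<Rightarrow> (\<lambda>r. (r, v)) ` ends (G v) f)\<rparr>"


section \<open>Chebyshev polynomials\<close>

definition chebyshev :: "nat \<Rightarrow> real poly" where
  "chebyshev k = (THE T. \<forall>w\<in>{-1..1}. poly T w = cos (real k * arccos w))"

lemma chebyshev_exists:
  "\<exists>T :: real poly. \<forall>w\<in>{-1..1}. poly T w = cos (real k * arccos w)"
proof (induction k rule: less_induct)
  case (less k)
  consider "k = 0" | "k = 1" | j where "k = Suc (Suc j)"
    by (metis One_nat_def not0_implies_Suc)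
  then show ?case
  proof cases
    case 1
    then show ?thesis by (intro exI[of _ 1]) simp
  next
    case 2
    then show ?thesis by (intro exI[of _ "[:0, 1:]"]) simp
  next
    case 3
    then obtain T U :: "real poly"
      where T: "\<And>w. w \<in> {-1..1} \<Longrightarrow> poly T w = cos (real j * arccos w)"
        and U: "\<And>w. w \<in> {-1..1} \<Longrightarrow> poly U w = cos (real (Suc j) * arccos w)"
      using less.IH[of j] less.IH[of "Suc j"] by (metis lessI less_SucI)
    have "poly ([:0, 2:] * U - T) w = cos (real k * arccos w)" if w: "w \<in> {-1..1}" for w
    proof -
      define x y where "x = arccos w" and "y = real (Suc j) * x"
      have x: "cos x = w" using w by (simp add: x_def)
      have "cos (y + x) + cos (y - x) = 2 * w * cos y"
        using x by (simp add: cos_add cos_diff)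
      moreover have "y + x = real k * x" "y - x = real j * x"
        by (simp_all add: y_def 3 algebra_simps)
      ultimately show ?thesis
        using T[OF w] U[OF w] by (simp add: x_def y_def)
    qed
    then show ?thesis by blast
  qed
qed

lemma poly_chebyshev:
  assumes "w \<in> {-1..1}"
  shows "poly (chebyshev k) w = cos (real k * arccos w)"
proof -
  obtain T :: "real poly" where T: "\<forall>w\<in>{-1..1}. poly T w = cos (real k * arccos w)"
    using chebyshev_exists by blast
  have "U = T" if U: "\<forall>w\<in>{-1..1}. poly U w = cos (real k * arccos w)" for U :: "real poly"
  proof (rule ccontr)
    assume "U \<noteq> T"
    then have "finite {w. poly (U - T) w = 0}"
      by (intro poly_roots_finite) simp
    moreover have "{-1..1} \<subseteq> {w. poly (U - T) w = 0}"
      using T U by auto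
    ultimately have "finite {-1..1 :: real}"
      by (rule rev_finite_subset)
    then show False by (simp add: infinite_Icc)
  qed
  then show ?thesis
    unfolding chebyshev_def
    using theI2[of "\<lambda>T. \<forall>w\<in>{-1..1}. poly T w = cos (real k * arccos w)" T
        "\<lambda>T. \<forall>w\<in>{-1..1}. poly T w = cos (real k * arccos w)"] T assms by blast
qed


section \<open>The associated polynomial\<close>

text \<open>
  In this section the base graph has vertex set \<open>{..<m}\<close>.  The matrix notions are those for
  matrices of dynamic dimension (not the type-indexed ones).
\<close>

definition adjacency_matrix :: "nat \<Rightarrow> (nat, 'e) multigraph \<Rightarrow> 'a::semiring_1 Matrix.mat" where
  "adjacency_matrix m H = Matrix.mat m m (\<lambda>(i, j). of_nat (edge_mult H i j))"

definition foliation_weight ::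
  "(nat, 'e) multigraph \<Rightarrow> (nat \<Rightarrow> nat) \<Rightarrow> (nat \<Rightarrow> nat \<Rightarrow> nat) \<Rightarrow> nat \<Rightarrow> real poly" where
  "foliation_weight H k s i =
     of_nat (2 * k i + mg_degree H i) - (\<Sum>p=1..k i. 2 * chebyshev (s i p))"

definition foliation_poly ::
  "nat \<Rightarrow> (nat, 'e) multigraph \<Rightarrow> (nat \<Rightarrow> nat) \<Rightarrow> (nat \<Rightarrow> nat \<Rightarrow> nat) \<Rightarrow> real poly" where
  "foliation_poly m H k s =
     Determinant.det (mat_diag m (foliation_weight H k s) - adjacency_matrix m H)"

end

theory Submission
  imports Defs "HOL-Real_Asymp.Real_Asymp"
begin

text \<open>
  Write \<open>L(H)\<close> for the Laplacian matrix of a multigraph \<open>H\<close> and \<open>\<kappa>(H)\<close> for its number of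
  spanning trees.  The proof has an exact part and an asymptotic part.

  Exact part.  By the matrix-tree theorem, \<open>det (L(G) + c J) = c N\<^sup>2 \<kappa>(G)\<close> for every multigraph
  \<open>G\<close> with \<open>N\<close> vertices, where \<open>J\<close> is the all-ones matrix (\<open>det_laplacian_add_const\<close>).  For the
  foliation \<open>H\<^sub>n\<close> the matrix \<open>L(H\<^sub>n) + J\<close> commutes with the cyclic shift of the layers, so the
  discrete Fourier transform in the first coordinate splits it into \<open>n\<close> blocks of size \<open>m\<close>
  (\<open>det_of_block_fourier\<close>).  The block of frequency \<open>\<alpha>\<close> is \<open>L(H)\<close> plus the diagonal matrix with
  entries \<open>\<Sum>\<^sub>p (2 - 2 cos (2 \<pi> s\<^sub>i\<^sub>p \<alpha> / n))\<close>, and its determinant is \<open>Q (cos (2 \<pi> \<alpha> / n))\<close>, by the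
  identity \<open>T\<^sub>s (cos \<theta>) = cos (s \<theta>)\<close>; only the block of frequency \<open>0\<close> sees \<open>J\<close>, and it is
  \<open>L(H) + n J\<close>.  Comparing the two evaluations gives (\<open>num_spanning_trees_foliation\<close>)
  \<open>n \<kappa>(H\<^sub>n) = \<kappa>(H) \<Prod>\<^bsub>\<alpha>=1..n-1\<^esub> Q (cos (2 \<pi> \<alpha> / n))\<close>.

  Asymptotic part.  At \<open>w = 1\<close> the matrix defining \<open>Q\<close> is \<open>L(H)\<close>, which is singular, so
  \<open>Q(w) = (2 - 2 w) R(w)\<close> for a polynomial \<open>R\<close>.  Since \<open>T\<^sub>s'(1) = s\<^sup>2\<close> and every principal
  minor of \<open>L(H)\<close> of order \<open>m - 1\<close> is \<open>\<kappa>(H)\<close>, the derivative of the determinant is \<open>Q'(1) = - 2 q \<kappa>(H)\<close>, that is,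
  \<open>R(1) = q \<kappa>(H)\<close>.  The numbers \<open>s\<^sub>i\<^sub>p\<close> have greatest common divisor 1, so when \<open>t\<close> is not an
  integer one of the sums \<open>\<Sum>\<^sub>p (2 - 2 cos (2 \<pi> s\<^sub>i\<^sub>p t))\<close> is positive; connectedness of \<open>H\<close> then
  makes the quadratic form definite, and \<open>R\<close> has no zero on \<open>[-1, 1]\<close>.  Hence the function
  \<open>g(t) = ln \<bar>R (cos 2 \<pi> t)\<bar>\<close> is smooth and periodic, so its Riemann sums satisfy
  \<open>\<Sum>\<^bsub>j<n\<^esub> g(j/n) - n \<integral> g \<rightarrow> 0\<close> (\<open>periodic_riemann_sum\<close>).
  The singular factor is explicit: \<open>\<Prod>\<^bsub>\<alpha>=1..n-1\<^esub> (2 - 2 cos (2 \<pi> \<alpha> / n)) = n\<^sup>2\<close>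
  (\<open>prod_chord_lengths\<close>) and \<open>\<integral> ln (2 - 2 cos 2 \<pi> t) = 0\<close> (\<open>integral_ln_chord\<close>), so \<open>ln A = \<integral> g\<close>.
  Together, \<open>\<kappa>(H\<^sub>n) = (\<kappa>(H) / n) n\<^sup>2 exp (\<Sum>\<^bsub>j<n\<^esub> g(j/n)) / (q \<kappa>(H)) = (n / q) A\<^sup>n exp (o(1))\<close>.
\<close>

section \<open>Spanning forests with prescribed roots\<close>

definition edge_rel :: "('v, 'e) multigraph \<Rightarrow> 'e set \<Rightarrow> ('v \<times> 'v) set" where
  "edge_rel G F = adjacency (G\<lparr>edges := F\<rparr>)"

definition spans_from :: "('v, 'e) multigraph \<Rightarrow> 'v set \<Rightarrow> 'e set \<Rightarrow> bool" where
  "spans_from G R F \<longleftrightarrow> verts G \<subseteq> (edge_rel G F)\<^sup>* `` R"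

text \<open>
  Rooted forests are the objects that survive deletion and contraction: instead of contracting
  an edge that leaves the root set, its other end point becomes a new root, and the vertex set
  stays fixed.  Acyclicity is encoded by the number of edges, which is the least possible one for
  a spanning edge set; this spares all reasoning about cycles in the recursion.
\<close>

definition rooted_forests :: "('v, 'e) multigraph \<Rightarrow> 'e set \<Rightarrow> 'v set \<Rightarrow> 'e set set" where
  "rooted_forests G E R = {F. F \<subseteq> E \<and> card F + card R = card (verts G) \<and> spans_from G R F}"

lemma edge_rel_iff: "(u, v) \<in> edge_rel G F \<longleftrightarrow> (\<exists>e\<in>F. ends G e = {u, v})"
  by (simp add: edge_rel_def adjacency_def)

lemma edge_rel_mono: "F \<subseteq> F' \<Longrightarrow> edge_rel G F \<subseteq> edge_rel G F'"
  unfolding edge_rel_def adjacency_def by fastforce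

lemma sym_edge_rel: "sym (edge_rel G F)"
  by (auto intro!: symI simp: edge_rel_iff insert_commute)

lemma rtrancl_leaves_set:
  assumes "(x, y) \<in> r\<^sup>*" "x \<in> R" "y \<notin> R"
  shows "\<exists>a b. a \<in> R \<and> b \<notin> R \<and> (a, b) \<in> r"
  using assms by (induction rule: rtrancl_induct) blast+

text \<open>
  A path that uses \<open>e\<close> can be started after its last passage through \<open>e\<close>, at one of the two end
  points, and both of them are roots in the conclusion.
\<close>

lemma spans_from_remove_edge:
  assumes "spans_from G R F" "ends G e = {r, v}" "r \<in> R"
  shows "spans_from G (insert v R) (F - {e})"
proof -
  have "y \<in> (edge_rel G (F - {e}))\<^sup>* `` insert v R"
    if "(x, y) \<in> (edge_rel G F)\<^sup>*" "x \<in> R" for x y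
    using that
  proof (induction rule: rtrancl_induct)
    case (step y z)
    then obtain e' where e': "e' \<in> F" "ends G e' = {y, z}"
      by (auto simp: edge_rel_iff)
    show ?case
    proof (cases "e' = e")
      case True
      then have "z \<in> insert v R" using e' assms by (auto simp: doubleton_eq_iff)
      then show ?thesis by blast
    next
      case False
      then have "(y, z) \<in> edge_rel G (F - {e})" using e' by (auto simp: edge_rel_iff)
      then show ?thesis using step by (meson Image_iff rtrancl.rtrancl_into_rtrancl)
    qed
  qed auto
  then show ?thesis using assms(1) unfolding spans_from_def by fast
qed

lemma spans_from_add_edge:
  assumes "spans_from G (insert v R) F" "e \<in> F'" "F \<subseteq> F'" "ends G e = {r, v}" "r \<in> R"
  shows "spans_from G R F'"
  unfolding spans_from_def
proof
  fix w assume "w \<in> verts G"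
  then obtain x where x: "x \<in> insert v R" "(x, w) \<in> (edge_rel G F)\<^sup>*"
    using assms(1) by (auto simp: spans_from_def)
  then have xw: "(x, w) \<in> (edge_rel G F')\<^sup>*"
    using assms(3) by (meson edge_rel_mono rtrancl_mono subsetD)
  have "(r, v) \<in> edge_rel G F'" using assms by (auto simp: edge_rel_iff)
  then have "x = v \<Longrightarrow> (r, w) \<in> (edge_rel G F')\<^sup>*"
    using xw by (meson converse_rtrancl_into_rtrancl)
  then show "w \<in> (edge_rel G F')\<^sup>* `` R" using x xw assms(5) by blast
qed

context
  fixes G :: "('v, 'e) multigraph"
  assumes G: "finite_loopfree G"
begin

lemma finite_graph [simp]: "finite (verts G)" "finite (edges G)"
  using G by (auto simp: finite_loopfree_def)

lemma ends_subset: "e \<in> edges G \<Longrightarrow> ends G e \<subseteq> verts G"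
  and card_ends: "e \<in> edges G \<Longrightarrow> card (ends G e) = 2"
  using G by (auto simp: finite_loopfree_def)

lemma crossing_edge:
  assumes "spans_from G R F" "F \<subseteq> edges G" "R \<subseteq> verts G" "R \<noteq> verts G"
  obtains e r v where "e \<in> F" "r \<in> R" "v \<in> verts G - R" "ends G e = {r, v}"
proof -
  obtain w where "w \<in> verts G" "w \<notin> R" using assms by blast
  then obtain x where "x \<in> R" "(x, w) \<in> (edge_rel G F)\<^sup>*"
    using assms(1) by (auto simp: spans_from_def)
  then obtain a b where ab: "a \<in> R" "b \<notin> R" "(a, b) \<in> edge_rel G F"
    using rtrancl_leaves_set[OF _ _ \<open>w \<notin> R\<close>] by blast
  then obtain e where e: "e \<in> F" "ends G e = {a, b}" by (auto simp: edge_rel_iff)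
  then have "b \<in> verts G" using ends_subset[of e] assms(2) by auto
  then show ?thesis using that[OF e(1) ab(1) _ e(2)] ab(2) by simp
qed

text \<open>
  Trading a crossing edge for a new root removes one edge and adds one root, until every
  vertex is a root.  The same recursion, read backwards, builds the forest in
  \<open>rooted_forest_exists\<close>.
\<close>

lemma card_verts_le_spanning:
  assumes "spans_from G R F" "F \<subseteq> edges G" "R \<subseteq> verts G"
  shows "card (verts G) \<le> card F + card R"
  using assms
proof (induction "card (verts G - R)" arbitrary: R F rule: less_induct)
  case less
  show ?case
  proof (cases "R = verts G")
    case False
    then obtain e r v where e: "e \<in> F" "r \<in> R" "v \<in> verts G - R" "ends G e = {r, v}"
      using crossing_edge less.prems by metis
    have f: "finite F" "finite R" using less.prems finite_subset[OF _ finite_graph(1)] finite_subset[OF _ finite_graph(2)] by auto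
    have "card (verts G - insert v R) < card (verts G - R)"
      using e by (intro psubset_card_mono) auto
    then have "card (verts G) \<le> card (F - {e}) + card (insert v R)"
      using spans_from_remove_edge[OF less.prems(1) e(4,2)] less.prems e
      by (intro less.hyps) auto
    moreover have "card (F - {e}) + 1 = card F" "card (insert v R) = card R + 1"
      using e f card_Suc_Diff1[of F e] by auto
    ultimately show ?thesis by linarith
  qed auto
qed

lemma rooted_forest_exists:
  assumes "spans_from G R E" "E \<subseteq> edges G" "R \<subseteq> verts G"
  shows "rooted_forests G E R \<noteq> {}"
  using assms
proof (induction "card (verts G - R)" arbitrary: R E rule: less_induct)
  case less
  show ?case
  proof (cases "R = verts G")
    case True
    then have "{} \<in> rooted_forests G E R" by (auto simp: rooted_forests_def spans_from_def)
    then show ?thesis by blast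
  next
    case False
    then obtain e r v where e: "e \<in> E" "r \<in> R" "v \<in> verts G - R" "ends G e = {r, v}"
      using crossing_edge less.prems by metis
    have "card (verts G - insert v R) < card (verts G - R)"
      using e by (intro psubset_card_mono) auto
    then have "rooted_forests G (E - {e}) (insert v R) \<noteq> {}"
      using spans_from_remove_edge[OF less.prems(1) e(4,2)] less.prems e
      by (intro less.hyps) auto
    then obtain F where F: "F \<subseteq> E - {e}" "card F + card (insert v R) = card (verts G)"
      "spans_from G (insert v R) F" by (auto simp: rooted_forests_def)
    have f: "finite F" "finite R" using F(1) less.prems finite_subset[OF _ finite_graph(1)] finite_subset[OF _ finite_graph(2), of F] by auto
    have "spans_from G R (insert e F)" using spans_from_add_edge[OF F(3) _ _ e(4,2)] by blast
    moreover have "e \<notin> F" "v \<notin> R" using F e by auto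
    ultimately have "insert e F \<in> rooted_forests G E R"
      using F e f by (auto simp: rooted_forests_def)
    then show ?thesis by blast
  qed
qed

text \<open>
  The deletion-contraction recursion; the second summand counts the forests that contain \<open>e\<close>.
\<close>

lemma rooted_forests_split:
  assumes E: "E \<subseteq> edges G" "e \<in> E" and R: "R \<subseteq> verts G" "r \<in> R" "v \<in> verts G - R"
    and e: "ends G e = {r, v}"
  shows "card (rooted_forests G E R) =
    card (rooted_forests G (E - {e}) R) + card (rooted_forests G (E - {e}) (insert v R))"
proof -
  have fE: "finite E" using E finite_subset finite_graph by blast
  have fR: "finite R" using R finite_subset finite_graph by blast
  let ?A = "rooted_forests G (E - {e}) R" and ?B = "rooted_forests G (E - {e}) (insert v R)"
  have fin_AB: "finite ?A" "finite ?B"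
    by (rule finite_subset[of _ "Pow E"]; use fE in \<open>auto simp: rooted_forests_def\<close>)+
  have "rooted_forests G E R = ?A \<union> insert e ` ?B"
  proof (intro equalityI subsetI)
    fix F assume F: "F \<in> rooted_forests G E R"
    show "F \<in> ?A \<union> insert e ` ?B"
    proof (cases "e \<in> F")
      case True
      have "finite F" using F finite_subset[OF _ fE, of F] by (auto simp: rooted_forests_def)
      then have "F - {e} \<in> ?B" using F True R fR spans_from_remove_edge[OF _ e R(2), of F]
        card_Suc_Diff1[of F e] by (auto simp: rooted_forests_def)
      then have "insert e (F - {e}) \<in> insert e ` ?B" by (rule imageI)
      then show ?thesis using True by (simp add: insert_absorb)
    qed (use F in \<open>auto simp: rooted_forests_def\<close>)
  next
    fix F assume "F \<in> ?A \<union> insert e ` ?B"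
    then consider "F \<in> ?A" | F' where "F' \<in> ?B" "F = insert e F'" by blast
    then show "F \<in> rooted_forests G E R"
    proof cases
      case 2
      then have "finite F'" using finite_subset[OF _ fE, of F'] by (auto simp: rooted_forests_def)
      then show ?thesis
        using 2 R E fR spans_from_add_edge[OF _ _ _ e R(2), of F' F]
        by (auto simp: rooted_forests_def card_insert_if)
    qed (auto simp: rooted_forests_def)
  qed
  moreover have "?A \<inter> insert e ` ?B = {}" by (auto simp: rooted_forests_def)
  moreover have "inj_on (insert e) ?B"
    by (rule inj_onI) (use insert_ident in \<open>fastforce simp: rooted_forests_def\<close>)
  ultimately show ?thesis using fin_AB by (simp add: card_Un_disjoint card_image)
qed

lemma mg_connected_iff_spans_from:
  assumes "r \<in> verts G"
  shows "mg_connected (G\<lparr>edges := F\<rparr>) \<longleftrightarrow> spans_from G {r} F"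
proof
  assume "spans_from G {r} F"
  then have *: "(r, v) \<in> (edge_rel G F)\<^sup>*" if "v \<in> verts G" for v
    using that by (auto simp: spans_from_def)
  then have "(v, r) \<in> (edge_rel G F)\<^sup>*" if "v \<in> verts G" for v
    using that sym_edge_rel sym_rtrancl symD by metis
  then have "(u, v) \<in> (edge_rel G F)\<^sup>*" if "u \<in> verts G" "v \<in> verts G" for u v
    using that * by (meson rtrancl_trans)
  then show "mg_connected (G\<lparr>edges := F\<rparr>)"
    using assms by (auto simp: mg_connected_def edge_rel_def)
qed (use assms in \<open>auto simp: mg_connected_def spans_from_def edge_rel_def\<close>)

text \<open>The end points of one edge of a cycle remain connected along the rest of the cycle.\<close>

lemma cycle_edge_redundant:
  assumes cyc: "mg_cycle (G\<lparr>edges := F\<rparr>) vs es"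
  shows "edge_rel G F \<subseteq> (edge_rel G (F - {last es}))\<^sup>*"
proof -
  let ?r = "(edge_rel G (F - {last es}))\<^sup>*"
  have c: "es \<noteq> []" "length vs = length es" "distinct es" "set es \<subseteq> F"
    "\<And>l. l < length es \<Longrightarrow> ends G (es ! l) = {vs ! l, vs ! (Suc l mod length es)}"
    using cyc by (auto simp: mg_cycle_def)
  have path: "(vs ! 0, vs ! l) \<in> ?r" if "l < length es" for l
    using that
  proof (induction l)
    case (Suc l)
    have "es ! l \<noteq> last es"
      using Suc.prems c nth_eq_iff_index_eq[of es l "length es - 1"] by (simp add: last_conv_nth)
    then have "(vs ! l, vs ! Suc l) \<in> edge_rel G (F - {last es})"
      using Suc.prems c(4) c(5)[of l] nth_mem[of l es] unfolding edge_rel_iff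
      by (intro bexI[of _ "es ! l"]) auto
    then show ?case using Suc by (meson Suc_lessD rtrancl.rtrancl_into_rtrancl)
  qed simp
  have "ends G (last es) = {vs ! (length es - 1), vs ! 0}"
    using c(1) c(5)[of "length es - 1"] by (simp add: last_conv_nth)
  moreover have *: "(vs ! 0, vs ! (length es - 1)) \<in> ?r" using c(1) path by simp
  moreover then have "(vs ! (length es - 1), vs ! 0) \<in> ?r"
    using sym_edge_rel sym_rtrancl symD by metis
  ultimately have last: "(u, v) \<in> ?r" if "ends G (last es) = {u, v}" for u v
    using that by (auto simp: doubleton_eq_iff)
  show ?thesis
  proof clarify
    fix u v assume "(u, v) \<in> edge_rel G F"
    then obtain e where "e \<in> F" "ends G e = {u, v}" by (auto simp: edge_rel_iff)
    then have "e \<noteq> last es \<Longrightarrow> (u, v) \<in> edge_rel G (F - {last es})"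
      unfolding edge_rel_iff by blast
    then show "(u, v) \<in> ?r" using last \<open>ends G e = {u, v}\<close> by (cases "e = last es") auto
  qed
qed

end

lemma rtrancl_distinct_path:
  assumes "(a, b) \<in> r\<^sup>*"
  obtains vs where "vs \<noteq> []" "hd vs = a" "last vs = b" "distinct vs"
    "\<forall>l. Suc l < length vs \<longrightarrow> (vs ! l, vs ! Suc l) \<in> r"
proof -
  from assms have "\<exists>vs. vs \<noteq> [] \<and> hd vs = a \<and> last vs = b \<and> distinct vs \<and>
    (\<forall>l. Suc l < length vs \<longrightarrow> (vs ! l, vs ! Suc l) \<in> r)"
  proof (induction rule: rtrancl_induct)
    case base
    show ?case by (intro exI[of _ "[a]"]) auto
  next
    case (step b c)
    then obtain vs where vs: "vs \<noteq> []" "hd vs = a" "last vs = b" "distinct vs"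
      "\<forall>l. Suc l < length vs \<longrightarrow> (vs ! l, vs ! Suc l) \<in> r" by blast
    show ?case
    proof (cases "c \<in> set vs")
      case True
      then obtain i where i: "i < length vs" "vs ! i = c" by (auto simp: in_set_conv_nth)
      then have "last (take (Suc i) vs) = c" by (simp add: take_Suc_conv_app_nth)
      then show ?thesis using vs i by (intro exI[of _ "take (Suc i) vs"]) auto
    next
      case False
      have "(b, c) \<in> r" by fact
      then have "((vs @ [c]) ! l, (vs @ [c]) ! Suc l) \<in> r" if "Suc l < length (vs @ [c])" for l
        using that vs by (cases "Suc l = length vs") (auto simp: nth_append last_conv_nth
          dest: arg_cong[of "Suc l" _ "\<lambda>x. x - 1"])
      then show ?thesis using vs False by (intro exI[of _ "vs @ [c]"]) auto
    qed
  qed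
  then show ?thesis using that by blast
qed

text \<open>
  This identifies the trees defined by the absence of cycles with the forests rooted in \<open>{r}\<close>.
  A cycle would leave a spanning edge set that is too small after one of its edges is removed.
  Conversely, an acyclic connected \<open>F\<close> contains a rooted forest \<open>F'\<close>; an edge of \<open>F\<close> outside \<open>F'\<close>
  would close a cycle with a path in \<open>F'\<close>.
\<close>

lemma mg_tree_iff:
  assumes G: "finite_loopfree G" and r: "r \<in> verts G" and F: "F \<subseteq> edges G"
  shows "mg_tree (G\<lparr>edges := F\<rparr>) \<longleftrightarrow> F \<in> rooted_forests G (edges G) {r}"
proof
  note [simp] = finite_graph[OF G]
  have fF: "finite F" using F finite_subset finite_graph[OF G] by blast
  assume "F \<in> rooted_forests G (edges G) {r}"
  then have c: "card F + 1 = card (verts G)" and sp: "spans_from G {r} F"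
    by (auto simp: rooted_forests_def)
  have "\<not> mg_cycle (G\<lparr>edges := F\<rparr>) vs es" for vs es
  proof
    assume cyc: "mg_cycle (G\<lparr>edges := F\<rparr>) vs es"
    then have "last es \<in> F" by (auto simp: mg_cycle_def)
    have "(edge_rel G F)\<^sup>* \<subseteq> (edge_rel G (F - {last es}))\<^sup>*"
      using cycle_edge_redundant[OF G cyc] by (metis rtrancl_idemp rtrancl_mono)
    then have "spans_from G {r} (F - {last es})" using sp by (auto simp: spans_from_def)
    then have "card (verts G) \<le> card (F - {last es}) + card {r}"
      using F r by (intro card_verts_le_spanning[OF G]) auto
    then show False using c card_Suc_Diff1[OF fF \<open>last es \<in> F\<close>] by simp
  qed
  then show "mg_tree (G\<lparr>edges := F\<rparr>)"
    using sp mg_connected_iff_spans_from[OF G r] by (auto simp: mg_tree_def)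
next
  assume tree: "mg_tree (G\<lparr>edges := F\<rparr>)"
  then have sp: "spans_from G {r} F"
    using mg_connected_iff_spans_from[OF G r] by (auto simp: mg_tree_def)
  then obtain F' where "F' \<in> rooted_forests G F {r}"
    using rooted_forest_exists[OF G sp F] r by blast
  then have F': "F' \<subseteq> F" "card F' + 1 = card (verts G)" "spans_from G {r} F'"
    by (auto simp: rooted_forests_def)
  have "F' = F"
  proof (rule ccontr)
    assume "F' \<noteq> F"
    then obtain e where e: "e \<in> F" "e \<notin> F'" using F' by blast
    then have "card (ends G e) = 2" using card_ends[OF G] F by blast
    then obtain a b where ab: "ends G e = {a, b}" "a \<noteq> b"
      by (auto simp: card_2_iff)
    then have "a \<in> verts G" "b \<in> verts G" using ends_subset[OF G, of e] e F by auto
    then have "(a, b) \<in> (edge_rel G F')\<^sup>*"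
      using F'(3) mg_connected_iff_spans_from[OF G r] by (auto simp: mg_connected_def edge_rel_def)
    then obtain vs where vs: "vs \<noteq> []" "hd vs = a" "last vs = b" "distinct vs"
      "\<forall>l. Suc l < length vs \<longrightarrow> (vs ! l, vs ! Suc l) \<in> edge_rel G F'"
      by (rule rtrancl_distinct_path)
    then have "\<forall>l. \<exists>e. Suc l < length vs \<longrightarrow> e \<in> F' \<and> ends G e = {vs ! l, vs ! Suc l}"
      by (meson edge_rel_iff)
    then obtain ed where ed: "\<And>l. Suc l < length vs \<Longrightarrow> ed l \<in> F' \<and> ends G (ed l) = {vs ! l, vs ! Suc l}"
      by metis
    define n where "n = length vs - 1"
    have n: "length vs = Suc n" using vs(1) by (simp add: n_def)
    define es where "es = map ed [0..<n] @ [e]"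
    have len: "length es = Suc n" by (simp add: es_def)
    have inj: "inj_on ed {..<n}"
    proof (rule inj_onI)
      fix x y assume xy: "x \<in> {..<n}" "y \<in> {..<n}" "ed x = ed y"
      then have "{vs ! x, vs ! Suc x} = {vs ! y, vs ! Suc y}" using ed n by (metis Suc_less_eq lessThan_iff)
      then show "x = y" using vs(4) xy n by (auto simp: doubleton_eq_iff nth_eq_iff_index_eq)
    qed
    have "vs ! 0 = a" "vs ! n = b"
      using vs(1-3) n by (auto simp: hd_conv_nth last_conv_nth)
    then have "ends G (es ! l) = {vs ! l, vs ! (Suc l mod length es)}" if "l < length es" for l
      using that ed[of l] n len ab
      by (cases "l = n") (auto simp: es_def nth_append)
    moreover have "distinct es"
      using e inj ed n by (auto simp: es_def distinct_map atLeast0LessThan)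
    moreover have "set es \<subseteq> F" using e ed n F' by (auto simp: es_def)
    moreover have "set vs \<subseteq> verts G"
    proof
      fix x assume "x \<in> set vs"
      then obtain i where i: "i < length vs" "x = vs ! i" by (auto simp: in_set_conv_nth)
      show "x \<in> verts G"
      proof (cases i)
        case 0
        then show ?thesis using i \<open>vs ! 0 = a\<close> \<open>a \<in> verts G\<close> by simp
      next
        case (Suc j)
        then show ?thesis using i ed[of j] ends_subset[OF G, of "ed j"] F' F by auto
      qed
    qed
    ultimately have "mg_cycle (G\<lparr>edges := F\<rparr>) vs es"
      using vs(4) n len by (auto simp: mg_cycle_def)
    then show False using tree by (auto simp: mg_tree_def)
  qed
  then show "F \<in> rooted_forests G (edges G) {r}"
    using F F' by (auto simp: rooted_forests_def)
qed

corollary num_spanning_trees_eq_rooted_forests: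
  assumes "finite_loopfree G" "r \<in> verts G"
  shows "num_spanning_trees G = card (rooted_forests G (edges G) {r})"
proof -
  have "{F. F \<subseteq> edges G \<and> mg_tree (G\<lparr>edges := F\<rparr>)} = rooted_forests G (edges G) {r}"
    using mg_tree_iff[OF assms] by (auto simp: rooted_forests_def)
  then show ?thesis by (simp add: num_spanning_trees_def)
qed

corollary num_spanning_trees_pos:
  assumes "finite_loopfree G" "mg_connected G"
  shows "num_spanning_trees G > 0"
proof -
  obtain r where r: "r \<in> verts G" using assms(2) by (auto simp: mg_connected_def)
  have "spans_from G {r} (edges G)"
    using assms mg_connected_iff_spans_from[OF assms(1) r, of "edges G"] by simp
  then have "rooted_forests G (edges G) {r} \<noteq> {}"
    using rooted_forest_exists assms(1) r by blast
  moreover have "finite (rooted_forests G (edges G) {r})"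
    by (rule finite_subset[of _ "Pow (edges G)"]) (use finite_graph[OF assms(1)] in \<open>auto simp: rooted_forests_def\<close>)
  ultimately show ?thesis
    using num_spanning_trees_eq_rooted_forests[OF assms(1) r] by (simp add: card_gt_0_iff)
qed

section \<open>Determinants and the matrix-tree theorem\<close>

text \<open>
  Matrices are handled as functions of their indices, so that the rows and columns of a
  Laplacian can be reindexed along an enumeration of the vertices by composition.
\<close>

definition det_of :: "nat \<Rightarrow> (nat \<Rightarrow> nat \<Rightarrow> 'a) \<Rightarrow> 'a :: comm_ring_1" where
  "det_of n g = Determinant.det (Matrix.mat n n (\<lambda>(i, j). g i j))"

text \<open>
  The rows and columns in \<open>S\<close> are replaced by those of the identity matrix.  The determinant of
  the result is the principal minor in which \<open>S\<close> is deleted, with no renumbering of the rest.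
\<close>

definition pin :: "'v set \<Rightarrow> ('v \<Rightarrow> 'v \<Rightarrow> 'a) \<Rightarrow> 'v \<Rightarrow> 'v \<Rightarrow> 'a :: comm_ring_1" where
  "pin S g u v = (if u \<in> S \<or> v \<in> S then of_bool (u = v) else g u v)"

lemma det_of_leibniz:
  "det_of n g = (\<Sum>p | p permutes {..<n}. signof p * (\<Prod>i<n. g i (p i)))"
proof -
  have "det_of n g = (\<Sum>p | p permutes {0..<n}. signof p * (\<Prod>i = 0..<n. Matrix.mat n n (\<lambda>(i, j). g i j) $$ (i, p i)))"
    unfolding det_of_def by (rule det_def') simp
  also have "\<dots> = (\<Sum>p | p permutes {0..<n}. signof p * (\<Prod>i = 0..<n. g i (p i)))"
    by (intro sum.cong refl arg_cong2[of _ _ _ _ "(*)"] prod.cong) (auto dest: permutes_in_image)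
  finally show ?thesis by (simp add: atLeast0LessThan)
qed

lemma det_of_cong:
  "(\<And>i j. i < n \<Longrightarrow> j < n \<Longrightarrow> g i j = h i j) \<Longrightarrow> det_of n g = det_of n h"
  unfolding det_of_def by (intro arg_cong[of _ _ Determinant.det] eq_matI) auto

lemma det_of_transpose: "det_of n (\<lambda>i j. g j i) = det_of n g"
proof -
  have "Matrix.mat n n (\<lambda>(i, j). g j i) = transpose_mat (Matrix.mat n n (\<lambda>(i, j). g i j))"
    by (intro eq_matI) auto
  then show ?thesis unfolding det_of_def
    using Determinant.det_transpose[of "Matrix.mat n n (\<lambda>(i, j). g i j)" n] by simp
qed

lemma det_of_mult:
  "det_of n (\<lambda>i j. \<Sum>k<n. g i k * h k j) = det_of n g * det_of n h"
proof -
  have "Matrix.mat n n (\<lambda>(i, j). \<Sum>k<n. g i k * h k j) =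
    Matrix.mat n n (\<lambda>(i, j). g i j) * Matrix.mat n n (\<lambda>(i, j). h i j)"
    by (intro eq_matI) (auto simp: scalar_prod_def atLeast0LessThan)
  then show ?thesis unfolding det_of_def by (simp add: Determinant.det_mult[of _ n])
qed

lemma det_of_eq_0_iff:
  fixes g :: "nat \<Rightarrow> nat \<Rightarrow> 'a :: field"
  shows "det_of n g = 0 \<longleftrightarrow> (\<exists>x. (\<exists>i<n. x i \<noteq> 0) \<and> (\<forall>i<n. (\<Sum>j<n. g i j * x j) = 0))"
proof -
  let ?A = "Matrix.mat n n (\<lambda>(i, j). g i j)"
  have mv: "(?A *\<^sub>v v = 0\<^sub>v n) = (\<forall>i<n. (\<Sum>j<n. g i j * (vec_index v j)) = 0)"
    if "v \<in> carrier_vec n" for v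
    using that by (auto simp: vec_eq_iff scalar_prod_def atLeast0LessThan)
  have nz: "(v \<noteq> 0\<^sub>v n) = (\<exists>i<n. vec_index v i \<noteq> 0)" if "v \<in> carrier_vec n" for v :: "'a Matrix.vec"
    using that by (auto simp: vec_eq_iff)
  have "det_of n g = 0 \<longleftrightarrow> (\<exists>v. v \<in> carrier_vec n \<and> v \<noteq> 0\<^sub>v n \<and> ?A *\<^sub>v v = 0\<^sub>v n)"
    unfolding det_of_def by (rule det_0_iff_vec_prod_zero_field) simp
  also have "\<dots> \<longleftrightarrow> (\<exists>v \<in> carrier_vec n. (\<exists>i<n. vec_index v i \<noteq> 0) \<and> (\<forall>i<n. (\<Sum>j<n. g i j * (vec_index v j)) = 0))"
    using mv nz by blast
  also have "\<dots> \<longleftrightarrow> (\<exists>x. (\<exists>i<n. x i \<noteq> 0) \<and> (\<forall>i<n. (\<Sum>j<n. g i j * x j) = 0))"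
  proof
    assume "\<exists>x. (\<exists>i<n. x i \<noteq> 0) \<and> (\<forall>i<n. (\<Sum>j<n. g i j * x j) = 0)"
    then obtain x where "\<exists>i<n. x i \<noteq> 0" "\<forall>i<n. (\<Sum>j<n. g i j * x j) = 0" by blast
    then show "\<exists>v \<in> carrier_vec n. (\<exists>i<n. vec_index v i \<noteq> 0) \<and> (\<forall>i<n. (\<Sum>j<n. g i j * (vec_index v j)) = 0)"
      by (intro bexI[of _ "Matrix.vec n x"]) auto
  qed blast
  finally show ?thesis .
qed

lemma det_of_one: "det_of n (\<lambda>i j. of_bool (i = j)) = (1 :: 'a :: comm_ring_1)"
proof -
  have "Matrix.mat n n (\<lambda>(i, j). of_bool (i = j)) = (1\<^sub>m n :: 'a mat)" by (intro eq_matI) auto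
  then show ?thesis by (simp add: det_of_def)
qed

lemma det_of_upper_triangular:
  assumes "\<And>i j. j < i \<Longrightarrow> i < n \<Longrightarrow> g i j = 0"
  shows "det_of n g = (\<Prod>i<n. g i i)"
proof -
  let ?A = "Matrix.mat n n (\<lambda>(i, j). g i j)"
  have "det_of n g = prod_list (diag_mat ?A)" unfolding det_of_def
    by (rule det_upper_triangular[of _ n]) (use assms in auto)
  also have "\<dots> = (\<Prod>i<n. g i i)"
    by (simp add: prod_list_diag_prod atLeast0LessThan)
  finally show ?thesis .
qed

lemma prod_pin:
  fixes n :: nat
  assumes "p permutes {..<n}" "i < n"
  shows "(\<Prod>j<n. pin {i} g j (p j)) = (if p i = i then \<Prod>j\<in>{..<n} - {i}. g j (p j) else 0)"
proof -
  have "(\<Prod>j<n. pin {i} g j (p j)) = pin {i} g i (p i) * (\<Prod>j\<in>{..<n} - {i}. pin {i} g j (p j))"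
    using assms by (intro prod.remove) auto
  moreover have "(\<Prod>j\<in>{..<n} - {i}. pin {i} g j (p j)) = (\<Prod>j\<in>{..<n} - {i}. g j (p j))" if "p i = i"
  proof -
    have "p j \<noteq> i" if "j \<noteq> i" for j using permutes_inj[OF assms(1)] that \<open>p i = i\<close> by (metis injD)
    then show ?thesis by (intro prod.cong refl) (auto simp: pin_def)
  qed
  ultimately show ?thesis by (auto simp: pin_def)
qed

text \<open>
  Only the permutations that fix \<open>v\<close> see the changed entry, and these are the ones that
  contribute to the pinned determinant.
\<close>

lemma det_of_add_diag:
  assumes "v < n"
  shows "det_of n (\<lambda>i j. g i j + (if i = v \<and> j = v then c else 0)) =
    det_of n g + c * det_of n (pin {v} g)"
proof -
  have "(\<Prod>i<n. g i (p i) + (if i = v \<and> p i = v then c else 0)) =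
    (\<Prod>i<n. g i (p i)) + c * (\<Prod>i<n. pin {v} g i (p i))" if p: "p permutes {..<n}" for p
  proof -
    note rem = prod.remove[OF finite_lessThan, of v n]
    have "(\<Prod>i\<in>{..<n} - {v}. g i (p i) + (if i = v \<and> p i = v then c else 0)) =
      (\<Prod>i\<in>{..<n} - {v}. g i (p i))" by (intro prod.cong) auto
    then show ?thesis using assms prod_pin[OF p assms, of g] by (simp add: rem distrib_right)
  qed
  then show ?thesis
    by (simp add: det_of_leibniz sum.distrib sum_distrib_left distrib_left mult.left_commute)
qed

definition laplacian :: "('v, 'e) multigraph \<Rightarrow> 'e set \<Rightarrow> 'v \<Rightarrow> 'v \<Rightarrow> 'a :: comm_ring_1" where
  "laplacian G E u v = (\<Sum>e\<in>E. if u \<in> ends G e \<and> v \<in> ends G e then (if u = v then 1 else - 1) else 0)"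

text \<open>
  The Laplacian acts as a sum over edges; every later computation with it goes through this form.
\<close>

lemma laplacian_apply:
  assumes G: "finite_loopfree G" and E: "E \<subseteq> edges G" and V: "finite V" "verts G \<subseteq> V"
  shows "(\<Sum>v\<in>V. laplacian G E u v * x v) =
    (\<Sum>e\<in>E. if u \<in> ends G e then \<Sum>v\<in>ends G e. x u - x v else 0)"
proof -
  have *: "(\<Sum>v\<in>V. (if u \<in> ends G e \<and> v \<in> ends G e then (if u = v then 1 else - 1) else 0) * x v) =
    (if u \<in> ends G e then \<Sum>v\<in>ends G e. x u - x v else 0)" if e: "e \<in> E" for e
  proof (cases "u \<in> ends G e")
    case True
    have "e \<in> edges G" using e E by blast
    then have "card (ends G e) = 2" "ends G e \<subseteq> V"
      using card_ends[OF G] ends_subset[OF G] V by auto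
    then obtain w where w: "ends G e = {u, w}" "u \<noteq> w"
      using True unfolding card_2_iff by (metis insert_commute insertE singletonD)
    have "(\<Sum>v\<in>V. (if u \<in> ends G e \<and> v \<in> ends G e then (if u = v then 1 else - 1) else 0) * x v) =
      (\<Sum>v\<in>ends G e. (if u = v then 1 else - 1) * x v)"
      by (rule sum.mono_neutral_cong_right) (use V True \<open>ends G e \<subseteq> V\<close> in auto)
    then show ?thesis using w by simp
  qed auto
  show ?thesis
    unfolding laplacian_def sum_distrib_right by (subst sum.swap) (use * in \<open>auto intro: sum.cong\<close>)
qed

lemma laplacian_commute: "laplacian G E u v = laplacian G E v u"
  unfolding laplacian_def by (intro sum.cong) auto

lemma laplacian_row_sum:
  assumes "finite_loopfree G" "E \<subseteq> edges G"
  shows "(\<Sum>v\<in>verts G. laplacian G E u v) = 0"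
  using laplacian_apply[OF assms _ order_refl, of u "\<lambda>_. 1"] finite_graph(1)[OF assms(1)]
  by (simp add: sum.neutral)

text \<open>
  The matrix-tree theorem for an arbitrary root set, by induction on the number of edges.
  Removing an edge \<open>e\<close> between a root and a vertex \<open>v\<close> that is not a root lowers the diagonal entry
  at \<open>v\<close> by one and changes no other entry that is not pinned, so \<open>det_of_add_diag\<close> is the
  determinantal form of \<open>rooted_forests_split\<close>.  If there is no such edge, the indicator function of
  the vertices that are not roots is in the kernel, unless all vertices are roots.
\<close>

theorem det_pinned_laplacian:
  fixes G :: "('v, 'e) multigraph"
  assumes G: "finite_loopfree G" and f: "bij_betw f {..<N} (verts G)"
    and "E \<subseteq> edges G" "R \<subseteq> verts G"
  shows "det_of N (\<lambda>i j. pin R (laplacian G E) (f i) (f j)) =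
    (of_nat (card (rooted_forests G E R)) :: 'a :: field)"
  using assms(3,4)
proof (induction "card E" arbitrary: E R rule: less_induct)
  case less
  note [simp] = finite_graph[OF G]
  have fin_E: "finite E" using less.prems finite_subset by (metis finite_graph(2)[OF G])
  have fV: "f i \<in> verts G" if "i < N" for i using f that by (auto simp: bij_betw_def)
  have f_eq: "f i = f j \<longleftrightarrow> i = j" if "i < N" "j < N" for i j
    using f that by (auto simp: bij_betw_def inj_on_def)
  consider "R = verts G"
    | "R \<noteq> verts G" "\<forall>e\<in>E. \<forall>r\<in>R. \<forall>v\<in>verts G - R. ends G e \<noteq> {r, v}"
    | e r v where "e \<in> E" "r \<in> R" "v \<in> verts G - R" "ends G e = {r, v}"
    by blast
  then show ?case
  proof cases
    case 1
    have "rooted_forests G E R = {{}}"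
      using 1 finite_subset[OF _ fin_E] by (auto simp: rooted_forests_def spans_from_def)
    moreover have "det_of N (\<lambda>i j. pin R (laplacian G E) (f i) (f j)) = (det_of N (\<lambda>i j. of_bool (i = j)) :: 'a)"
      using 1 fV f_eq by (intro det_of_cong) (auto simp: pin_def)
    ultimately show ?thesis by (simp add: det_of_one)
  next
    case 2
    have "rooted_forests G E R = {}"
    proof (rule equals0I)
      fix F assume "F \<in> rooted_forests G E R"
      then have F: "spans_from G R F" "F \<subseteq> E" by (auto simp: rooted_forests_def)
      obtain e r v where "e \<in> F" "r \<in> R" "v \<in> verts G - R" "ends G e = {r, v}"
        by (rule crossing_edge[OF G F(1)]) (use F less.prems 2 in auto)
      then show False using 2 F by blast
    qed
    moreover have "det_of N (\<lambda>i j. pin R (laplacian G E) (f i) (f j)) = (0 :: 'a)"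
    proof -
      let ?x = "\<lambda>v. of_bool (v \<notin> R) :: 'a"
      obtain w where "w \<in> verts G" "w \<notin> R" using 2 less.prems by blast
      then obtain i where "i < N" "f i = w" using f by (metis bij_betw_iff_bijections lessThan_iff)
      then have nonzero: "\<exists>i<N. ?x (f i) \<noteq> 0"
        using \<open>w \<notin> R\<close> by (intro exI[of _ i]) simp
      have "(\<Sum>j<N. pin R (laplacian G E) (f i) (f j) * ?x (f j)) = 0" if i: "i < N" for i
      proof -
        have "(\<Sum>j<N. pin R (laplacian G E) (f i) (f j) * ?x (f j)) =
          (\<Sum>v\<in>verts G. pin R (laplacian G E) (f i) v * ?x v)"
          by (rule sum.reindex_bij_betw[OF f])
        also have "\<dots> = 0"
        proof (cases "f i \<in> R")
          case True
          then show ?thesis by (intro sum.neutral) (auto simp: pin_def)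
        next
          case False
          then have "(\<Sum>v\<in>verts G. pin R (laplacian G E) (f i) v * ?x v) = (\<Sum>v\<in>verts G. laplacian G E (f i) v * ?x v)"
            by (intro sum.cong) (auto simp: pin_def)
          also have "\<dots> = (\<Sum>e\<in>E. if f i \<in> ends G e then \<Sum>v\<in>ends G e. ?x (f i) - ?x v else 0)"
            by (rule laplacian_apply[OF G less.prems(1)]) auto
          also have "\<dots> = 0"
          proof (rule sum.neutral, rule ballI)
            fix e assume e: "e \<in> E"
            then have c: "card (ends G e) = 2" using card_ends[OF G] less.prems by blast
            have "v \<notin> R" if "f i \<in> ends G e" "v \<in> ends G e" for v
            proof
              assume "v \<in> R"
              then have "v \<noteq> f i" using False by auto
              then have "ends G e = {v, f i}" using c that by (auto simp: card_2_iff)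
              then show False using 2 e \<open>v \<in> R\<close> False fV[OF i] by blast
            qed
            then show "(if f i \<in> ends G e then \<Sum>v\<in>ends G e. ?x (f i) - ?x v else 0) = 0"
              using False by (auto intro!: sum.neutral)
          qed
          finally show ?thesis .
      qed
      finally show ?thesis .
      qed
      then show ?thesis
        unfolding det_of_eq_0_iff using nonzero by (intro exI[of _ "\<lambda>i. ?x (f i)"]) blast
    qed
    ultimately show ?thesis by simp
  next
    case 3
    obtain k where k: "k < N" "f k = v" using f 3 by (metis DiffD1 bij_betw_iff_bijections lessThan_iff)
    have small: "card (E - {e}) < card E" using 3 fin_E by (intro psubset_card_mono) auto
    let ?g = "\<lambda>i j. pin R (laplacian G (E - {e})) (f i) (f j) :: 'a"
    have split: "laplacian G E u w = laplacian G (E - {e}) u w +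
      (if u \<in> ends G e \<and> w \<in> ends G e then (if u = w then 1 else - 1) else 0 :: 'a)" for u w
      unfolding laplacian_def by (subst sum.remove[OF fin_E 3(1)]) (rule add.commute)
    have "det_of N (\<lambda>i j. pin R (laplacian G E) (f i) (f j)) =
      det_of N (\<lambda>i j. ?g i j + (if i = k \<and> j = k then 1 else 0))"
    proof (rule det_of_cong)
      fix i j assume ij: "i < N" "j < N"
      then show "pin R (laplacian G E) (f i) (f j) = ?g i j + (if i = k \<and> j = k then 1 else 0)"
        using 3 k f_eq[of i k] f_eq[of j k] f_eq[of i j] by (auto simp: pin_def split)
    qed
    also have "\<dots> = det_of N ?g + det_of N (pin {k} ?g)"
      using det_of_add_diag[OF k(1), of ?g 1] by simp
    also have "det_of N (pin {k} ?g) = det_of N (\<lambda>i j. pin (insert v R) (laplacian G (E - {e})) (f i) (f j))"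
      using k f_eq by (intro det_of_cong) (auto simp: pin_def)
    also have "\<dots> = of_nat (card (rooted_forests G (E - {e}) (insert v R)))"
      using small less.prems 3 by (intro less.hyps) auto
    also have "det_of N ?g = of_nat (card (rooted_forests G (E - {e}) R))"
      using small less.prems by (intro less.hyps) auto
    finally show ?thesis
      using rooted_forests_split[OF G less.prems(1) 3(1) less.prems(2) 3(2-4)] by simp
  qed
qed

corollary matrix_tree:
  assumes G: "finite_loopfree G" and f: "bij_betw f {..<N} (verts G)" and r: "r < N"
  shows "det_of N (pin {r} (\<lambda>i j. laplacian G (edges G) (f i) (f j))) = (of_nat (num_spanning_trees G) :: 'a :: field)"
proof -
  have fr: "f r \<in> verts G" using f r by (auto simp: bij_betw_def)
  have "det_of N (pin {r} (\<lambda>i j. laplacian G (edges G) (f i) (f j))) =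
    (det_of N (\<lambda>i j. pin {f r} (laplacian G (edges G)) (f i) (f j)) :: 'a)"
    using f r by (intro det_of_cong) (auto simp: pin_def bij_betw_def inj_on_def)
  then show ?thesis
    using det_pinned_laplacian[OF G f order_refl, of "{f r}"] fr
      num_spanning_trees_eq_rooted_forests[OF G fr] by simp
qed

text \<open>
  With zero row and column sums, \<open>L + c J = T K T\<^sup>t\<close>, where \<open>T\<close> has the all-ones vector as column
  \<open>0\<close> and \<open>e\<^sub>j - e\<^sub>0\<close> as its other columns, and \<open>K\<close> is the pinned matrix with \<open>c\<close> in the corner.
\<close>

lemma det_of_add_const:
  fixes L :: "nat \<Rightarrow> nat \<Rightarrow> 'a :: idom"
  assumes N: "0 < N"
    and row: "\<And>i. i < N \<Longrightarrow> (\<Sum>j<N. L i j) = 0"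
    and col: "\<And>j. j < N \<Longrightarrow> (\<Sum>i<N. L i j) = 0"
  shows "det_of N (\<lambda>i j. L i j + c) = c * of_nat N ^ 2 * det_of N (pin {0} L)"
proof -
  define T :: "nat \<Rightarrow> nat \<Rightarrow> 'a" where
    "T = (\<lambda>i j. if j = 0 then 1 else if i = 0 then - 1 else of_bool (i = j))"
  \<comment> \<open>\<open>Z\<close> is unipotent and \<open>T Z\<close> is upper triangular with diagonal \<open>N, 1, \<dots>, 1\<close>, hence
    \<open>det T = N\<close>.\<close>
  define Z :: "nat \<Rightarrow> nat \<Rightarrow> 'a" where
    "Z = (\<lambda>i j. if j = 0 then (if i = 0 then 1 else - 1) else of_bool (i = j))"
  define K where "K = (\<lambda>i j. pin {0} L i j + (if i = 0 \<and> j = 0 then c - 1 else 0))"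
  have split0: "(\<Sum>k<N. h k) = h 0 + (\<Sum>k\<in>{..<N} - {0}. h k)" for h :: "nat \<Rightarrow> 'a"
    using sum.remove[of "{..<N}" 0 h] N by simp
  \<comment> \<open>Multiplication by \<open>T\<close> in closed form; all products below are instances.\<close>
  have TH: "(\<Sum>k<N. T i k * h k) = h 0 + (if i = 0 then - (\<Sum>k\<in>{..<N} - {0}. h k) else h i)"
    if "i < N" for i h
  proof (cases "i = 0")
    case True
    then show ?thesis by (subst split0) (simp add: T_def sum_negf)
  next
    case False
    then have "(\<Sum>k\<in>{..<N} - {0}. T i k * h k) = (\<Sum>k\<in>{..<N} - {0}. if i = k then h k else 0)"
      by (intro sum.cong) (auto simp: T_def)
    then show ?thesis using False that by (subst split0) (simp add: T_def)
  qed
  have "det_of N T * det_of N Z = det_of N (\<lambda>i j. \<Sum>k<N. T i k * Z k j)"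
    by (rule det_of_mult[symmetric])
  also have "\<dots> = (\<Prod>i<N. \<Sum>k<N. T i k * Z k i)"
    by (rule det_of_upper_triangular) (subst TH, auto simp: Z_def)
  also have "\<dots> = (\<Prod>i<N. if i = 0 then of_nat N else 1)"
  proof (intro prod.cong refl)
    fix i assume "i \<in> {..<N}"
    then show "(\<Sum>k<N. T i k * Z k i) = (if i = 0 then of_nat N else 1)"
      using N by (subst TH) (auto simp: Z_def of_nat_diff sum_negf)
  qed
  also have "\<dots> = of_nat N" using N by simp
  finally have TZ: "det_of N T * det_of N Z = of_nat N" .
  have "det_of N Z = det_of N (\<lambda>i j. Z j i)" by (rule det_of_transpose[symmetric])
  also have "\<dots> = (\<Prod>i<N. Z i i)" by (rule det_of_upper_triangular) (auto simp: Z_def)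
  also have "\<dots> = 1" by (rule prod.neutral) (auto simp: Z_def)
  finally have detT: "det_of N T = of_nat N" using TZ by simp
  have "pin {0} (pin {0} L) = pin {0} L" by (auto simp: pin_def fun_eq_iff)
  then have detK: "det_of N K = c * det_of N (pin {0} L)"
    using det_of_add_diag[OF N, of "pin {0} L" "c - 1"] by (simp add: K_def algebra_simps)
  have TK: "(\<Sum>k<N. T i k * K k l) = (if l = 0 then c else L i l)" if "i < N" "l < N" for i l
  proof -
    have "(\<Sum>k<N. L k l) = L 0 l + (\<Sum>k\<in>{..<N} - {0}. L k l)" by (rule split0)
    then have "- (\<Sum>k\<in>{..<N} - {0}. L k l) = L 0 l"
      using col[OF that(2)] by (simp add: add_eq_0_iff)
    moreover have "(\<Sum>k\<in>{..<N} - {0}. K k l) = (\<Sum>k\<in>{..<N} - {0}. L k l)" if "l \<noteq> 0"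
      using that by (intro sum.cong) (auto simp: K_def pin_def)
    moreover have "(\<Sum>k\<in>{..<N} - {0}. K k 0) = 0"
      by (intro sum.neutral) (auto simp: K_def pin_def)
    ultimately show ?thesis using that by (subst TH) (auto simp: K_def pin_def)
  qed
  have "det_of N (\<lambda>i j. L i j + c) = det_of N (\<lambda>i j. \<Sum>l<N. (\<Sum>k<N. T i k * K k l) * T j l)"
  proof (rule det_of_cong)
    fix i j assume ij: "i < N" "j < N"
    have "(\<Sum>l<N. (\<Sum>k<N. T i k * K k l) * T j l) = (\<Sum>l<N. T j l * (if l = 0 then c else L i l))"
      using ij by (intro sum.cong) (auto simp: TK)
    also have "\<dots> = c + (if j = 0 then - (\<Sum>k\<in>{..<N} - {0}. L i k) else L i j)"
      using ij by (subst TH) (auto intro: sum.cong)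
    also have "\<dots> = c + L i j"
      using row[OF ij(1)] split0[of "L i"] by (auto simp: add_eq_0_iff)
    finally show "L i j + c = (\<Sum>l<N. (\<Sum>k<N. T i k * K k l) * T j l)" by simp
  qed
  also have "\<dots> = det_of N (\<lambda>i j. \<Sum>k<N. T i k * K k j) * det_of N (\<lambda>i j. T j i)"
    by (rule det_of_mult)
  also have "\<dots> = det_of N T * det_of N K * det_of N T"
    by (simp only: det_of_mult det_of_transpose[of N T])
  finally show ?thesis by (simp add: detT detK power2_eq_square)
qed

corollary det_laplacian_add_const:
  assumes G: "finite_loopfree G" and f: "bij_betw f {..<N} (verts G)" and N: "0 < N"
  shows "det_of N (\<lambda>i j. laplacian G (edges G) (f i) (f j) + c) =
    (c * of_nat N ^ 2 * of_nat (num_spanning_trees G) :: 'a :: field)"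
proof -
  have row: "(\<Sum>j<N. laplacian G (edges G) u (f j)) = (0 :: 'a)" for u
    using sum.reindex_bij_betw[OF f] laplacian_row_sum[OF G order_refl] by metis
  have "(\<Sum>i<N. laplacian G (edges G) (f i) u) = (0 :: 'a)" for u
    using row[of u] by (simp add: laplacian_commute[of G _ u])
  then have "det_of N (\<lambda>i j. laplacian G (edges G) (f i) (f j) + c) =
    c * of_nat N ^ 2 * det_of N (pin {0} (\<lambda>i j. laplacian G (edges G) (f i) (f j)))"
    using row by (intro det_of_add_const[OF N])
  then show ?thesis by (simp add: matrix_tree[OF G f N])
qed

section \<open>Spanning trees of a circulant foliation\<close>

lemma sum_div_mod:
  "(\<Sum>a<n * m. h (a div m) (a mod m)) = (\<Sum>k<n. \<Sum>i<m. h k i)" for m n :: nat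
proof -
  have "(\<Sum>a = k * m..<k * m + m. h (a div m) (a mod m)) = (\<Sum>i<m. h k i)" for k
  proof -
    have "(\<Sum>a = k * m..<k * m + m. h (a div m) (a mod m)) =
      (\<Sum>i = 0..<m. h ((i + k * m) div m) ((i + k * m) mod m))"
      using sum.shift_bounds_nat_ivl[of "\<lambda>a. h (a div m) (a mod m)" 0 "k * m" m]
      by (simp add: add.commute)
    also have "\<dots> = (\<Sum>i<m. h k i)" by (intro sum.cong) auto
    finally show ?thesis .
  qed
  then show ?thesis by (simp add: sum.nat_group[symmetric])
qed

lemma det_of_block_diag:
  fixes B :: "nat \<Rightarrow> nat \<Rightarrow> nat \<Rightarrow> 'a :: idom"
  shows "det_of (n * m) (\<lambda>a b. if a div m = b div m then B (a div m) (a mod m) (b mod m) else 0) =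
    (\<Prod>k<n. det_of m (B k))"
proof (induction n)
  case 0
  show ?case by (simp add: det_of_leibniz)
next
  case (Suc n)
  let ?g = "\<lambda>a b. if a div m = b div m then B (a div m) (a mod m) (b mod m) else 0"
  let ?A = "\<lambda>N. Matrix.mat N N (\<lambda>(a, b). ?g a b)"
  have lt: "a div m < n" if "a < n * m" for a
    using that by (simp add: less_mult_imp_div_less)
  have dm: "a div m = n" "a mod m = a - n * m" if "n * m \<le> a" "a < n * m + m" for a
  proof -
    define i where "i = a - n * m"
    have "a = i + n * m" "i < m" using that by (auto simp: i_def)
    then show "a div m = n" "a mod m = a - n * m" by auto
  qed
  have "?A (n * m + m) = four_block_mat (?A (n * m)) (0\<^sub>m (n * m) m) (0\<^sub>m m (n * m))
    (Matrix.mat m m (\<lambda>(i, j). B n i j))"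
    (is "_ = ?F")
  proof (rule eq_matI)
    fix i j assume "i < dim_row ?F" "j < dim_col ?F"
    then have ij: "i < n * m + m" "j < n * m + m" by auto
    have "i div m \<noteq> j div m" if "i < n * m" "n * m \<le> j"
      using lt[OF that(1)] dm(1)[OF that(2) ij(2)] by simp
    moreover have "i div m \<noteq> j div m" if "j < n * m" "n * m \<le> i"
      using lt[OF that(1)] dm(1)[OF that(2) ij(1)] by simp
    ultimately show "?A (n * m + m) $$ (i, j) = ?F $$ (i, j)"
      using ij dm[of i] dm[of j] by (auto simp: not_less)
  qed auto
  then have "Determinant.det (?A (n * m + m)) =
    Determinant.det (?A (n * m)) * Determinant.det (Matrix.mat m m (\<lambda>(i, j). B n i j))"
    by (simp add: det_four_block_mat_upper_right_zero[of _ "n * m" _ m])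
  then show ?case using Suc.IH by (simp add: det_of_def add.commute mult.commute)
qed

lemma sum_cis:
  assumes "0 < n"
  shows "(\<Sum>\<alpha><n. cis (2 * pi * of_int d * real \<alpha> / real n)) = (if int n dvd d then of_nat n else 0)"
proof -
  define z where "z = cis (2 * pi * of_int d / real n)"
  have pow: "cis (2 * pi * of_int d * real \<alpha> / real n) = z ^ \<alpha>" for \<alpha>
    unfolding z_def Complex.DeMoivre by (rule arg_cong[of _ _ cis]) simp
  have zn: "z ^ n = 1"
    using assms cis_multiple_2pi[of "of_int d"] by (simp add: z_def Complex.DeMoivre)
  have "z = 1 \<longleftrightarrow> int n dvd d"
  proof
    assume "z = 1"
    then have "cos (2 * pi * of_int d / real n) = 1" by (metis z_def cis.sel(1) one_complex.sel(1))
    then obtain k :: int where "2 * pi * of_int d / real n = of_int k * 2 * pi"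
      using cos_one_2pi_int by blast
    then have "of_int d = (of_int k * real n :: real)" using assms by (simp add: field_simps)
    then have "d = k * int n" by (metis of_int_eq_iff of_int_mult of_int_of_nat_eq)
    then show "int n dvd d" by simp
  next
    assume "int n dvd d"
    then obtain k where "d = int n * k" by blast
    then have "2 * pi * of_int d / real n = 2 * pi * of_int k" using assms by simp
    then show "z = 1" using cis_multiple_2pi[of "of_int k"] by (simp add: z_def)
  qed
  then show ?thesis using zn geometric_sum[of z n] by (auto simp: pow)
qed

text \<open>
  The assumption says that the vectors \<open>(cis (2 \<pi> l \<alpha> / n) e\<^sub>\<beta>)\<^sub>l\<close> span subspaces, one for each
  frequency \<open>\<alpha>\<close>, that \<open>g\<close> preserves and on which it acts as \<open>B \<alpha>\<close>.  These vectors are the columns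
  of \<open>W\<close>, so \<open>g W = W D\<close> with \<open>D\<close> block diagonal, and \<open>W W\<^sup>* = n I\<close> shows that \<open>W\<close> is invertible.
\<close>

lemma det_of_block_fourier:
  fixes g :: "nat \<times> nat \<Rightarrow> nat \<times> nat \<Rightarrow> complex"
  assumes n: "0 < n"
    and eig: "\<And>\<alpha> \<beta> k i. \<alpha> < n \<Longrightarrow> \<beta> < m \<Longrightarrow> k < n \<Longrightarrow> i < m \<Longrightarrow>
      (\<Sum>l<n. g (k, i) (l, \<beta>) * cis (2 * pi * real l * real \<alpha> / real n)) =
      cis (2 * pi * real k * real \<alpha> / real n) * B \<alpha> i \<beta>"
  shows "det_of (n * m) (\<lambda>a b. g (a div m, a mod m) (b div m, b mod m)) = (\<Prod>\<alpha><n. det_of m (B \<alpha>))"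
proof -
  let ?e = "\<lambda>k \<alpha>. cis (2 * pi * real k * real \<alpha> / real n)"
  define W where "W = (\<lambda>a b. if a mod m = b mod m then ?e (a div m) (b div m) else 0)"
  define D where "D = (\<lambda>a b. if a div m = b div m then B (a div m) (a mod m) (b mod m) else 0)"
  let ?g = "\<lambda>a b. g (a div m, a mod m) (b div m, b mod m)"
  have dm: "a div m < n" "a mod m < m" if "a < n * m" for a
    using that by (simp_all add: less_mult_imp_div_less) (metis mod_less_divisor mult_0_right neq0_conv not_less0)
  have gW: "(\<Sum>c<n * m. ?g a c * W c b) = (\<Sum>c<n * m. W a c * D c b)"
    if a: "a < n * m" and b: "b < n * m" for a b
  proof -
    have "(\<Sum>c<n * m. ?g a c * W c b) = (\<Sum>l<n. \<Sum>j<m. g (a div m, a mod m) (l, j) *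
      (if j = b mod m then ?e l (b div m) else 0))"
      unfolding W_def by (rule sum_div_mod)
    also have "\<dots> = (\<Sum>l<n. g (a div m, a mod m) (l, b mod m) * ?e l (b div m))"
      using dm[OF b] by (intro sum.cong refl) (simp add: if_distrib[of "(*) _"] cong: if_cong)
    also have "\<dots> = ?e (a div m) (b div m) * B (b div m) (a mod m) (b mod m)"
      using dm[OF a] dm[OF b] by (intro eig) auto
    also have "\<dots> = (\<Sum>\<gamma><n. if \<gamma> = b div m then ?e (a div m) \<gamma> * B \<gamma> (a mod m) (b mod m) else 0)"
      using dm[OF b] by simp
    also have "\<dots> = (\<Sum>\<gamma><n. \<Sum>j<m. (if a mod m = j then ?e (a div m) \<gamma> else 0) *
        (if \<gamma> = b div m then B \<gamma> j (b mod m) else 0))"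
      using dm[OF a] by (intro sum.cong refl) (simp add: if_distribR if_distrib[of "\<lambda>x. x * _"] cong: if_cong)
    also have "\<dots> = (\<Sum>c<n * m. W a c * D c b)"
      unfolding W_def D_def by (rule sum_div_mod[symmetric])
    finally show ?thesis .
  qed
  have "(\<Sum>c<n * m. W a c * cnj (W b c)) = of_nat n * of_bool (a = b)"
    if a: "a < n * m" and b: "b < n * m" for a b
  proof -
    have "(\<Sum>c<n * m. W a c * cnj (W b c)) = (\<Sum>\<gamma><n. \<Sum>j<m.
      (if a mod m = j then ?e (a div m) \<gamma> else 0) * cnj (if b mod m = j then ?e (b div m) \<gamma> else 0))"
      unfolding W_def by (rule sum_div_mod)
    also have "\<dots> = (\<Sum>\<gamma><n. if a mod m = b mod m then ?e (a div m) \<gamma> * cnj (?e (b div m) \<gamma>) else 0)"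
      using dm[OF a] by (intro sum.cong refl) (simp add: if_distribR if_distrib[of "\<lambda>x. x * _"] cong: if_cong)
    also have "\<dots> = (if a mod m = b mod m then
      (\<Sum>\<gamma><n. cis (2 * pi * of_int (int (a div m) - int (b div m)) * real \<gamma> / real n)) else 0)"
      by (simp add: cis_cnj cis_mult diff_divide_distrib algebra_simps)
    also have "\<dots> = (if a mod m = b mod m \<and> int n dvd int (a div m) - int (b div m) then of_nat n else 0)"
      by (simp only: sum_cis[OF n]) simp
    also have "a mod m = b mod m \<and> int n dvd int (a div m) - int (b div m) \<longleftrightarrow> a = b"
    proof
      assume *: "a mod m = b mod m \<and> int n dvd int (a div m) - int (b div m)"
      have "\<bar>int (a div m) - int (b div m)\<bar> < int n" using dm(1)[OF a] dm(1)[OF b] by linarith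
      then have "int (a div m) - int (b div m) = 0"
        using * dvd_imp_le_int[of "int (a div m) - int (b div m)" "int n"] by linarith
      then have "a div m = b div m" by linarith
      then show "a = b" using * by (metis div_mult_mod_eq)
    qed auto
    finally show ?thesis by simp
  qed
  then have "det_of (n * m) W * det_of (n * m) (\<lambda>c b. cnj (W b c)) =
    det_of (n * m) (\<lambda>a b. of_nat n * of_bool (a = b))"
    unfolding det_of_mult[symmetric] by (intro det_of_cong)
  also have "\<dots> = of_nat n ^ (n * m)" by (subst det_of_upper_triangular) auto
  finally have W: "det_of (n * m) W \<noteq> 0" using n by auto
  have "det_of (n * m) ?g * det_of (n * m) W = det_of (n * m) W * det_of (n * m) D"
    unfolding det_of_mult[symmetric] using gW by (intro det_of_cong)
  then have "det_of (n * m) ?g = det_of (n * m) D" using W by simp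
  then show ?thesis by (simp add: D_def det_of_block_diag)
qed

lemma det_of_of_real: "det_of n (\<lambda>i j. of_real (g i j)) = of_real (det_of n g)"
  by (simp add: det_of_leibniz sign_def)

context
  fixes m n :: nat and H :: "(nat, 'e) multigraph" and k :: "nat \<Rightarrow> nat" and s :: "nat \<Rightarrow> nat \<Rightarrow> nat"
  assumes H: "finite_loopfree H" and VH: "verts H = {..<m}"
    and s_pos: "\<And>i p. i < m \<Longrightarrow> p \<in> {1..k i} \<Longrightarrow> 1 \<le> s i p"
    and s_le: "\<And>i p. i < m \<Longrightarrow> p \<in> {1..k i} \<Longrightarrow> 2 * s i p \<le> n"
    and n: "0 < n"
begin

abbreviation (input) "Fol \<equiv> foliation n H (\<lambda>i. circulant n (k i) (s i))"

lemma edges_foliation: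
  "edges Fol = (\<lambda>(r, e). Base r e) ` ({..<n} \<times> edges H) \<union>
    (\<lambda>(v, f). Fiber v f) ` (SIGMA v:{..<m}. {..<n} \<times> {1..k v})"
  by (auto simp: foliation_def circulant_def VH)

lemma verts_foliation: "verts Fol = {..<n} \<times> {..<m}"
  by (simp add: foliation_def VH)

lemma ends_Base: "ends Fol (Base r e) = Pair r ` ends H e"
  and ends_Fiber: "ends Fol (Fiber v (r, p)) = {(r, v), ((r + s v p) mod n, v)}"
  by (auto simp: foliation_def circulant_def)

lemma shift_neq:
  assumes "i < m" "p \<in> {1..k i}" "r < n"
  shows "(r + s i p) mod n \<noteq> r"
proof
  assume "(r + s i p) mod n = r"
  then have "n dvd s i p" using assms(3) by (metis mod_eq_dvd_iff_nat le_add1 add_diff_cancel_left' mod_less)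
  then show False using s_pos[OF assms(1,2)] s_le[OF assms(1,2)] n by (auto dest: dvd_imp_le)
qed

lemma finite_loopfree_foliation: "finite_loopfree Fol"
proof -
  have "finite (edges Fol)" unfolding edges_foliation using finite_graph(2)[OF H] by auto
  moreover have "ends Fol x \<subseteq> verts Fol \<and> card (ends Fol x) = 2" if x: "x \<in> edges Fol" for x
  proof -
    from x consider r e where "x = Base r e" "r < n" "e \<in> edges H"
      | v r p where "x = Fiber v (r, p)" "v < m" "r < n" "p \<in> {1..k v}"
      unfolding edges_foliation by auto
    then show ?thesis
    proof cases
      case 1
      then show ?thesis using ends_subset[OF H, of e] card_ends[OF H, of e] VH
        unfolding verts_foliation 1(1) ends_Base by (auto simp: card_image inj_on_def)
    next
      case 2
      define r' where "r' = (r + s v p) mod n"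
      have "r' < n" "r' \<noteq> r" using shift_neq[OF 2(2,4,3)] n by (simp_all add: r'_def)
      then show ?thesis using 2(2,3) unfolding verts_foliation 2(1) ends_Fiber r'_def[symmetric] by auto
    qed
  qed
  moreover have "finite (verts Fol)" unfolding verts_foliation by simp
  ultimately show ?thesis unfolding finite_loopfree_def by blast
qed

lemma bij_betw_verts_foliation: "bij_betw (\<lambda>a. (a div m, a mod m)) {..<n * m} (verts Fol)"
  unfolding verts_foliation
proof (rule bij_betwI[where g = "\<lambda>(r, i). r * m + i"])
  show "(\<lambda>a. (a div m, a mod m)) \<in> {..<n * m} \<rightarrow> {..<n} \<times> {..<m}"
  proof
    fix a assume "a \<in> {..<n * m}"
    then have "a < n * m" "0 < m" by (auto intro: Nat.gr0I)
    then show "(a div m, a mod m) \<in> {..<n} \<times> {..<m}" by (simp add: less_mult_imp_div_less)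
  qed
  show "(\<lambda>(r, i). r * m + i) \<in> {..<n} \<times> {..<m} \<rightarrow> {..<n * m}"
  proof
    fix x assume "x \<in> {..<n} \<times> {..<m}"
    then obtain r i where x: "x = (r, i)" "r < n" "i < m" by auto
    have "r * m + i < Suc r * m" using x by simp
    also have "\<dots> \<le> n * m" using x by (intro mult_le_mono1) simp
    finally show "(case x of (r, i) \<Rightarrow> r * m + i) \<in> {..<n * m}" using x by simp
  qed
qed auto

lemma shift_eq_iff:
  assumes "\<kappa> < n" "r < n" "t \<le> n"
  shows "(r + t) mod n = \<kappa> \<longleftrightarrow> r = (\<kappa> + n - t) mod n"
proof -
  have "x mod n = (if x < n then x else x - n)" if "x < n + n" for x
    using that by (simp add: le_mod_geq)
  note this[of "r + t"] this[of "\<kappa> + n - t"]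
  then show ?thesis using assms by (cases "r + t < n"; cases "\<kappa> + n - t < n"; simp; linarith)
qed

text \<open>
  The Laplacian of the foliation is that of \<open>H\<close> in each layer plus that of a circulant
  graph in each fiber.  For \<open>2 s = n\<close> the two shifts coincide, in accordance with the double edge.
\<close>

lemma laplacian_foliation_apply:
  fixes x :: "nat \<times> nat \<Rightarrow> 'a :: comm_ring_1"
  assumes \<kappa>: "\<kappa> < n" and i: "i < m"
  shows "(\<Sum>v\<in>verts Fol. laplacian Fol (edges Fol) (\<kappa>, i) v * x v) =
    (\<Sum>w<m. laplacian H (edges H) i w * x (\<kappa>, w)) +
    (\<Sum>p = 1..k i. 2 * x (\<kappa>, i) - x ((\<kappa> + s i p) mod n, i) - x ((\<kappa> + n - s i p) mod n, i))"
proof -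
  define t where "t = (\<lambda>e. if (\<kappa>, i) \<in> ends Fol e then \<Sum>v\<in>ends Fol e. x (\<kappa>, i) - x v else 0)"
  have "(\<Sum>v\<in>verts Fol. laplacian Fol (edges Fol) (\<kappa>, i) v * x v) = (\<Sum>e\<in>edges Fol. t e)"
    unfolding t_def using finite_loopfree_foliation by (intro laplacian_apply) (auto simp: finite_graph)
  also have "\<dots> = sum t ((\<lambda>(r, e). Base r e) ` ({..<n} \<times> edges H)) +
    sum t ((\<lambda>(v, f). Fiber v f) ` (SIGMA v:{..<m}. {..<n} \<times> {1..k v}))"
    unfolding edges_foliation using finite_graph(2)[OF H] by (intro sum.union_disjoint) auto
  also have "sum t ((\<lambda>(r, e). Base r e) ` ({..<n} \<times> edges H)) = (\<Sum>r<n. \<Sum>e\<in>edges H. t (Base r e))"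
    by (subst sum.reindex) (auto simp: inj_on_def sum.cartesian_product intro!: sum.cong)
  also have "\<dots> = (\<Sum>r<n. if r = \<kappa> then \<Sum>e\<in>edges H. t (Base \<kappa> e) else 0)"
    by (intro sum.cong refl) (auto simp: t_def ends_Base intro!: sum.neutral)
  also have "\<dots> = (\<Sum>e\<in>edges H. t (Base \<kappa> e))" using \<kappa> by simp
  also have "\<dots> = (\<Sum>e\<in>edges H. if i \<in> ends H e then \<Sum>v\<in>ends H e. x (\<kappa>, i) - x (\<kappa>, v) else 0)"
    by (intro sum.cong refl) (auto simp: t_def ends_Base sum.reindex inj_on_def)
  also have "\<dots> = (\<Sum>w<m. laplacian H (edges H) i w * x (\<kappa>, w))"
    using VH by (intro laplacian_apply[symmetric] H) auto
  also have "sum t ((\<lambda>(v, f). Fiber v f) ` (SIGMA v:{..<m}. {..<n} \<times> {1..k v})) =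
    (\<Sum>v<m. \<Sum>p = 1..k v. \<Sum>r<n. t (Fiber v (r, p)))"
  proof -
    have "inj_on (\<lambda>(v, f). Fiber v f) (SIGMA v:{..<m}. {..<n} \<times> {1..k v})"
      by (auto simp: inj_on_def)
    then have "sum t ((\<lambda>(v, f). Fiber v f) ` (SIGMA v:{..<m}. {..<n} \<times> {1..k v})) =
      (\<Sum>(v, f)\<in>(SIGMA v:{..<m}. {..<n} \<times> {1..k v}). t (Fiber v f))"
      by (subst sum.reindex) (simp_all add: comp_def split_def)
    also have "\<dots> = (\<Sum>v<m. \<Sum>f\<in>{..<n} \<times> {1..k v}. t (Fiber v f))"
      by (rule sum.Sigma[symmetric]) auto
    also have "\<dots> = (\<Sum>v<m. \<Sum>p = 1..k v. \<Sum>r<n. t (Fiber v (r, p)))"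
      by (intro sum.cong refl) (simp add: sum.cartesian_product', rule sum.swap)
    finally show ?thesis .
  qed
  also have "\<dots> = (\<Sum>v<m. if v = i then \<Sum>p = 1..k i. \<Sum>r<n. t (Fiber i (r, p)) else 0)"
    by (intro sum.cong refl) (auto simp: t_def ends_Fiber intro!: sum.neutral)
  also have "\<dots> = (\<Sum>p = 1..k i. \<Sum>r<n. t (Fiber i (r, p)))" using i by simp
  also have "\<dots> = (\<Sum>p = 1..k i. 2 * x (\<kappa>, i) - x ((\<kappa> + s i p) mod n, i) - x ((\<kappa> + n - s i p) mod n, i))"
  proof (intro sum.cong refl)
    fix p assume p: "p \<in> {1..k i}"
    let ?s = "s i p"
    let ?r = "(\<kappa> + n - ?s) mod n"
    have s: "?s \<le> n" "0 < ?s" using s_le[OF i p] s_pos[OF i p] by auto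
    have r: "?r < n" using n by simp
    have r': "(?r + ?s) mod n = \<kappa>" using shift_eq_iff[OF \<kappa> r s(1)] by simp
    have neq: "?r \<noteq> \<kappa>" using shift_neq[OF i p \<kappa>] r' by auto
    have "t (Fiber i (r, p)) = (if r = \<kappa> then x (\<kappa>, i) - x ((\<kappa> + ?s) mod n, i) else 0) +
      (if r = ?r then x (\<kappa>, i) - x (?r, i) else 0)" if "r < n" for r
      using shift_eq_iff[OF \<kappa> that s(1)] shift_neq[OF i p that] neq r'
      by (auto simp: t_def ends_Fiber)
    then have "(\<Sum>r<n. t (Fiber i (r, p))) = (\<Sum>r<n. (if r = \<kappa> then x (\<kappa>, i) - x ((\<kappa> + ?s) mod n, i) else 0) +
      (if r = ?r then x (\<kappa>, i) - x (?r, i) else 0))" by (intro sum.cong) auto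
    also have "\<dots> = x (\<kappa>, i) - x ((\<kappa> + ?s) mod n, i) + (x (\<kappa>, i) - x (?r, i))"
      using \<kappa> r by (simp add: sum.distrib)
    finally show "(\<Sum>r<n. t (Fiber i (r, p))) = 2 * x (\<kappa>, i) - x ((\<kappa> + ?s) mod n, i) - x (?r, i)"
      by simp
  qed
  finally show ?thesis .
qed

end

text \<open>
  The Fourier block of the Laplacian of the foliation at the angle \<open>\<theta>\<close>; its determinant is
  \<open>Q (cos \<theta>)\<close>.
\<close>

definition symbol_matrix :: "(nat, 'e) multigraph \<Rightarrow> (nat \<Rightarrow> nat) \<Rightarrow> (nat \<Rightarrow> nat \<Rightarrow> nat) \<Rightarrow> real \<Rightarrow> nat \<Rightarrow> nat \<Rightarrow> real" where
  "symbol_matrix H k s \<theta> i j =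
    laplacian H (edges H) i j + (if i = j then \<Sum>p = 1..k i. 2 - 2 * cos (real (s i p) * \<theta>) else 0)"

lemma cis_mod_nat:
  assumes "0 < n"
  shows "cis (2 * pi * real (a mod n) * real \<alpha> / real n) = cis (2 * pi * real a * real \<alpha> / real n)"
proof -
  have "real a = real (a mod n) + real (a div n) * real n"
    by (metis add.commute div_mult_mod_eq of_nat_add of_nat_mult)
  then have "2 * pi * real a * real \<alpha> / real n =
    2 * pi * real (a mod n) * real \<alpha> / real n + 2 * pi * real (a div n * \<alpha>)"
    using assms by (simp add: field_simps)
  moreover have "cis (2 * pi * real (a div n * \<alpha>)) = 1"
    using cis_multiple_2pi[of "real (a div n * \<alpha>)"] by simp
  ultimately show ?thesis by (metis cis_mult mult.right_neutral)
qed

text \<open>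
  Adding \<open>J\<close> makes the Laplacian of the foliation invertible without destroying the circulant
  structure.  Since \<open>J\<close> annihilates all characters except the trivial one, it changes only the
  block of frequency \<open>0\<close>, where \<open>det_laplacian_add_const\<close> applies once more, now to \<open>H\<close>.
\<close>

theorem num_spanning_trees_foliation:
  fixes H :: "(nat, 'e) multigraph"
  assumes H: "finite_loopfree H" and VH: "verts H = {..<m}" and m: "0 < m"
    and s_pos: "\<And>i p. i < m \<Longrightarrow> p \<in> {1..k i} \<Longrightarrow> 1 \<le> s i p"
    and s_le: "\<And>i p. i < m \<Longrightarrow> p \<in> {1..k i} \<Longrightarrow> 2 * s i p \<le> n"
    and n: "0 < n"
  shows "real n * real (num_spanning_trees (foliation n H (\<lambda>i. circulant n (k i) (s i)))) =
    real (num_spanning_trees H) * (\<Prod>\<alpha> = 1..<n. det_of m (symbol_matrix H k s (2 * pi * real \<alpha> / real n)))"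
proof -
  let ?Fol = "foliation n H (\<lambda>i. circulant n (k i) (s i))"
  note ctx = H VH s_pos s_le n
  define B where "B = (\<lambda>\<alpha> i j. symbol_matrix H k s (2 * pi * real \<alpha> / real n) i j +
    (if \<alpha> = 0 then real n else 0))"
  let ?e = "\<lambda>l \<alpha>. cis (2 * pi * real l * real \<alpha> / real n)"
  have eig: "(\<Sum>l<n. (laplacian ?Fol (edges ?Fol) (\<kappa>, i) (l, \<beta>) + 1) * ?e l \<alpha>) = ?e \<kappa> \<alpha> * of_real (B \<alpha> i \<beta>)"
    if b: "\<alpha> < n" "\<beta> < m" "\<kappa> < n" "i < m" for \<alpha> \<beta> \<kappa> i
  proof -
    \<comment> \<open>The column \<open>(\<alpha>, \<beta>)\<close> of the Fourier matrix: a character in the fiber over \<open>\<beta>\<close>.\<close>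
    define x where "x = (\<lambda>(l, j). if j = \<beta> then ?e l \<alpha> else 0)"
    have V: "verts ?Fol = {..<n} \<times> {..<m}" by (simp add: foliation_def VH)
    have "(\<Sum>l<n. laplacian ?Fol (edges ?Fol) (\<kappa>, i) (l, \<beta>) * ?e l \<alpha>) =
      (\<Sum>v\<in>verts ?Fol. laplacian ?Fol (edges ?Fol) (\<kappa>, i) v * x v)"
      unfolding V x_def sum.cartesian_product' using b
      by (simp add: if_distrib[of "(*) _"] cong: if_cong)
    also have "\<dots> = (\<Sum>w<m. laplacian H (edges H) i w * x (\<kappa>, w)) +
      (\<Sum>p = 1..k i. 2 * x (\<kappa>, i) - x ((\<kappa> + s i p) mod n, i) - x ((\<kappa> + n - s i p) mod n, i))"
      by (rule laplacian_foliation_apply[OF ctx]) (use b in auto)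
    also have "(\<Sum>w<m. laplacian H (edges H) i w * x (\<kappa>, w)) = ?e \<kappa> \<alpha> * laplacian H (edges H) i \<beta>"
      using b by (simp add: x_def if_distrib[of "(*) _"] cong: if_cong)
    also have "(\<Sum>p = 1..k i. 2 * x (\<kappa>, i) - x ((\<kappa> + s i p) mod n, i) - x ((\<kappa> + n - s i p) mod n, i)) =
      (\<Sum>p = 1..k i. ?e \<kappa> \<alpha> * (if i = \<beta> then of_real (2 - 2 * cos (real (s i p) * (2 * pi * real \<alpha> / real n))) else 0))"
    proof (intro sum.cong refl)
      fix p assume p: "p \<in> {1..k i}"
      let ?\<phi> = "real (s i p) * (2 * pi * real \<alpha> / real n)"
      have "s i p \<le> \<kappa> + n" using s_le[OF b(4) p] by linarith
      then have "2 * pi * real (\<kappa> + n - s i p) * real \<alpha> / real n =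
        2 * pi * real \<kappa> * real \<alpha> / real n + - ?\<phi> + 2 * pi * real \<alpha>"
        using n by (simp add: of_nat_diff field_simps)
      moreover have "cis (2 * pi * real \<alpha>) = 1" using cis_multiple_2pi[of "real \<alpha>"] by simp
      ultimately have 1: "?e (\<kappa> + n - s i p) \<alpha> = ?e \<kappa> \<alpha> * cis (- ?\<phi>)"
        by (metis cis_mult mult.right_neutral)
      have "2 * pi * real (\<kappa> + s i p) * real \<alpha> / real n = 2 * pi * real \<kappa> * real \<alpha> / real n + ?\<phi>"
        by (simp add: algebra_simps add_divide_distrib)
      then have 2: "?e (\<kappa> + s i p) \<alpha> = ?e \<kappa> \<alpha> * cis ?\<phi>" by (metis cis_mult)
      have "cis ?\<phi> + cis (- ?\<phi>) = of_real (2 * cos ?\<phi>)"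
        by (simp add: complex_eq_iff)
      then have "2 - cis ?\<phi> - cis (- ?\<phi>) = of_real (2 - 2 * cos ?\<phi>)"
        by (simp add: algebra_simps)
      moreover have "2 * ?e \<kappa> \<alpha> - ?e \<kappa> \<alpha> * cis ?\<phi> - ?e \<kappa> \<alpha> * cis (- ?\<phi>) =
        ?e \<kappa> \<alpha> * (2 - cis ?\<phi> - cis (- ?\<phi>))" by (simp add: right_diff_distrib)
      ultimately have "2 * ?e \<kappa> \<alpha> - ?e \<kappa> \<alpha> * cis ?\<phi> - ?e \<kappa> \<alpha> * cis (- ?\<phi>) =
        ?e \<kappa> \<alpha> * of_real (2 - 2 * cos ?\<phi>)" by (simp only:)
      then show "2 * x (\<kappa>, i) - x ((\<kappa> + s i p) mod n, i) - x ((\<kappa> + n - s i p) mod n, i) =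
        ?e \<kappa> \<alpha> * (if i = \<beta> then of_real (2 - 2 * cos ?\<phi>) else 0)"
        unfolding x_def prod.case cis_mod_nat[OF n] 1 2
        by (cases "i = \<beta>") (simp_all only: if_True if_False simp_thms mult_zero_right diff_self)
    qed
    also have "\<dots> = ?e \<kappa> \<alpha> * (if i = \<beta> then of_real (\<Sum>p = 1..k i. 2 - 2 * cos (real (s i p) * (2 * pi * real \<alpha> / real n))) else 0)"
      by (simp add: sum_distrib_left[symmetric])
    also have "?e \<kappa> \<alpha> * laplacian H (edges H) i \<beta> + \<dots> = ?e \<kappa> \<alpha> * of_real (symbol_matrix H k s (2 * pi * real \<alpha> / real n) i \<beta>)"
      by (simp add: symbol_matrix_def laplacian_def distrib_left of_real_sum if_distrib[of of_real] cong: if_cong)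
    finally have L: "(\<Sum>l<n. laplacian ?Fol (edges ?Fol) (\<kappa>, i) (l, \<beta>) * ?e l \<alpha>) =
      ?e \<kappa> \<alpha> * of_real (symbol_matrix H k s (2 * pi * real \<alpha> / real n) i \<beta>)" .
    have "(\<Sum>l<n. ?e l \<alpha>) = (\<Sum>l<n. cis (2 * pi * of_int (int \<alpha>) * real l / real n))"
      by (simp add: mult.commute mult.left_commute)
    also have "\<dots> = (if int n dvd int \<alpha> then of_nat n else 0)" by (rule sum_cis[OF n])
    also have "\<dots> = ?e \<kappa> \<alpha> * of_real (if \<alpha> = 0 then real n else 0)"
      using b by (auto dest: dvd_imp_le)
    finally show ?thesis
      by (simp add: distrib_right sum.distrib L B_def distrib_left)
  qed
  have "of_real (real (n * m) ^ 2 * real (num_spanning_trees ?Fol)) =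
    (1 * of_nat (n * m) ^ 2 * of_nat (num_spanning_trees ?Fol) :: complex)" by simp
  also have "\<dots> = det_of (n * m) (\<lambda>a b. laplacian ?Fol (edges ?Fol) (a div m, a mod m) (b div m, b mod m) + 1)"
    using m n by (intro det_laplacian_add_const[symmetric]
        finite_loopfree_foliation[OF ctx] bij_betw_verts_foliation[OF ctx]) auto
  also have "\<dots> = (\<Prod>\<alpha><n. det_of m (\<lambda>i j. of_real (B \<alpha> i j)))"
    by (rule det_of_block_fourier[OF n, of m "\<lambda>u v. laplacian ?Fol (edges ?Fol) u v + 1"]) (rule eig)
  also have "\<dots> = of_real (\<Prod>\<alpha><n. det_of m (B \<alpha>))"
    by (simp add: det_of_of_real)
  finally have "real (n * m) ^ 2 * real (num_spanning_trees ?Fol) = (\<Prod>\<alpha><n. det_of m (B \<alpha>))"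
    using of_real_eq_iff by blast
  also have "\<dots> = det_of m (B 0) * (\<Prod>\<alpha> = 1..<n. det_of m (B \<alpha>))"
    using n prod.atLeast_Suc_lessThan[of 0 n "\<lambda>\<alpha>. det_of m (B \<alpha>)"] by (simp add: atLeast0LessThan)
  also have "det_of m (B 0) = det_of m (\<lambda>i j. laplacian H (edges H) i j + real n)"
    by (intro det_of_cong) (auto simp: B_def symbol_matrix_def)
  also have "\<dots> = real n * real m ^ 2 * real (num_spanning_trees H)"
    using det_laplacian_add_const[OF H, of "\<lambda>i. i" m "real n"] bij_betw_id[of "{..<m}"] VH m
    by (simp add: id_def)
  also have "(\<Prod>\<alpha> = 1..<n. det_of m (B \<alpha>)) = (\<Prod>\<alpha> = 1..<n. det_of m (symbol_matrix H k s (2 * pi * real \<alpha> / real n)))"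
    by (intro prod.cong refl det_of_cong) (auto simp: B_def)
  finally show ?thesis using m n by (simp add: power2_eq_square)
qed

section \<open>Riemann sums of periodic functions and the chord integral\<close>

text \<open>
  As a function of \<open>h\<close>, the error vanishes at \<open>0\<close>, and its derivative is
  \<open>(g (a + h) - g a) / 2 - h g' (a + h) / 2\<close>, which two applications of the mean value theorem bound
  by \<open>C h\<^sup>2 / 2\<close>.
\<close>

lemma trapezoid_error:
  fixes g g' g'' :: "real \<Rightarrow> real"
  assumes g: "\<And>t. (g has_real_derivative g' t) (at t)"
    and g': "\<And>t. (g' has_real_derivative g'' t) (at t)"
    and C: "\<And>t. a \<le> t \<Longrightarrow> t \<le> a + h \<Longrightarrow> \<bar>g'' t\<bar> \<le> C"
    and h: "0 \<le> h"
  shows "\<bar>integral {a..a + h} g - h * (g a + g (a + h)) / 2\<bar> \<le> C * h ^ 3 / 2"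
proof -
  have C0: "0 \<le> C" using C[of a] h by linarith
  have cont: "continuous_on S g" for S
    using g by (meson DERIV_isCont continuous_at_imp_continuous_on)
  define E where "E = (\<lambda>x. integral {a..a + x} g - x * (g a + g (a + x)) / 2)"
  define E' where "E' = (\<lambda>x. g (a + x) - ((g a + g (a + x)) / 2 + x * g' (a + x) / 2))"
  have I: "((\<lambda>x. integral {a..x} g) has_real_derivative g x) (at x within {a..a + h})"
    if "x \<in> {a..a + h}" for x
    using integral_has_real_derivative[OF cont that] .
  have DI: "((\<lambda>x. integral {a..a + x} g) has_real_derivative g (a + x)) (at x within {0..h})"
    if x: "x \<in> {0..h}" for x
  proof -
    have "((\<lambda>y. integral {a..y} g) \<circ> (\<lambda>x. a + x) has_real_derivative g (a + x) * 1) (at x within {0..h})"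
      by (rule DERIV_image_chain) (use x I in \<open>auto intro!: derivative_eq_intros simp: image_add_atLeastAtMost add.commute[of h a]\<close>)
    then show ?thesis by (simp add: comp_def)
  qed
  have Dg: "((\<lambda>x. g (a + x)) has_real_derivative g' (a + x)) (at x within S)" for x S
  proof -
    have "((\<lambda>x. a + x) has_real_derivative 1) (at x within S)"
      by (auto intro!: derivative_eq_intros)
    then show ?thesis using DERIV_chain2[OF g] by fastforce
  qed
  have DE: "(E has_real_derivative E' x) (at x within {0..h})" if "x \<in> {0..h}" for x
    unfolding E_def E'_def
    by (rule derivative_eq_intros DI Dg that refl | simp add: algebra_simps add_divide_distrib)+
  have bound: "norm (E' x) \<le> C * h\<^sup>2 / 2" if x: "x \<in> {0..h}" for x
  proof (cases "x = 0")
    case True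
    then show ?thesis using C0 by (simp add: E'_def)
  next
    case False
    then have "0 < x" using x by simp
    then obtain z where z: "a < z" "z < a + x" "g (a + x) - g a = x * g' z"
      using MVT2[of a "a + x" g g'] g by auto
    have "z < a + x" by fact
    then obtain y where y: "z < y" "y < a + x" "g' (a + x) - g' z = (a + x - z) * g'' y"
      using MVT2[of z "a + x" g' g''] g' by auto
    have "E' x = - (x / 2) * (g' (a + x) - g' z)"
      using z(3) by (simp add: E'_def field_simps)
    also have "\<dots> = - (x / 2) * ((a + x - z) * g'' y)" by (simp only: y(3))
    finally have "norm (E' x) = (x / 2) * ((a + x - z) * \<bar>g'' y\<bar>)"
      using \<open>0 < x\<close> z by (simp add: abs_mult)
    also have "\<dots> \<le> (h / 2) * (h * C)"
      using x z y \<open>0 < x\<close> C[of y] by (intro mult_mono) auto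
    finally show ?thesis by (simp add: power2_eq_square mult_ac)
  qed
  have "norm (E h - E 0) \<le> C * h\<^sup>2 / 2 * norm (h - 0)"
    by (rule field_differentiable_bound[where S = "{0..h}" and f' = E']) (use DE bound h in auto)
  then show ?thesis using h by (simp add: E_def power2_eq_square power3_eq_cube mult_ac)
qed

text \<open>
  Periodicity makes the Riemann sum equal to the trapezoidal sum, whose error is of order
  \<open>n\<^sup>-\<^sup>2\<close>; this beats the factor \<open>n\<close>, which an ordinary Riemann sum error of order \<open>1 / n\<close> would not.
\<close>

lemma periodic_riemann_sum:
  fixes g g' g'' :: "real \<Rightarrow> real"
  assumes g: "\<And>t. (g has_real_derivative g' t) (at t)"
    and g': "\<And>t. (g' has_real_derivative g'' t) (at t)"
    and g'': "continuous_on {0..1} g''"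
    and periodic: "g 0 = g 1"
  shows "(\<lambda>n. (\<Sum>j<n. g (real j / real n)) - real n * integral {0..1} g) \<longlonglongrightarrow> 0"
proof -
  have "bounded (g'' ` {0..1})"
    using g'' by (intro compact_imp_bounded compact_continuous_image) auto
  then obtain C where "\<And>y. y \<in> g'' ` {0..1} \<Longrightarrow> norm y \<le> C" unfolding bounded_iff by blast
  then have C: "\<bar>g'' t\<bar> \<le> C" if "t \<in> {0..1}" for t using that by auto
  have cont: "continuous_on S g" for S
    using g by (meson DERIV_isCont continuous_at_imp_continuous_on)
  have int: "g integrable_on {a..b}" for a b
    by (rule integrable_continuous_real[OF cont])
  have bound: "\<bar>(\<Sum>j<n. g (real j / real n)) - real n * integral {0..1} g\<bar> \<le> C / 2 * (1 / real n)"
    if n: "0 < n" for n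
  proof -
    let ?a = "\<lambda>j. real j / real n"
    have step: "?a (Suc j) = ?a j + 1 / real n" for j by (simp add: add_divide_distrib)
    have "integral {0..?a k} g = (\<Sum>j<k. integral {?a j..?a (Suc j)} g)" for k
    proof (induction k)
      case (Suc k)
      have "integral {0..?a k} g + integral {?a k..?a (Suc k)} g = integral {0..?a (Suc k)} g"
        by (rule Henstock_Kurzweil_Integration.integral_combine) (auto simp: int divide_right_mono)
      then show ?case using Suc by simp
    qed auto
    from this[of n] have I: "integral {0..1} g = (\<Sum>j<n. integral {?a j..?a (Suc j)} g)"
      using n by simp
    have "(\<Sum>j<k. g (?a (Suc j))) = (\<Sum>j<k. g (?a j)) + g (?a k) - g (?a 0)" for k
      by (induction k) auto
    from this[of n] have "(\<Sum>j<n. g (?a (Suc j))) = (\<Sum>j<n. g (?a j))" using n periodic by simp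
    then have "(\<Sum>j<n. g (?a j)) = real n * (\<Sum>j<n. (1 / real n) * (g (?a j) + g (?a (Suc j))) / 2)"
      using n by (simp add: sum_divide_distrib[symmetric] sum_distrib_left[symmetric] sum.distrib)
    then have "(\<Sum>j<n. g (?a j)) - real n * integral {0..1} g =
      - real n * (\<Sum>j<n. integral {?a j..?a (Suc j)} g - (1 / real n) * (g (?a j) + g (?a (Suc j))) / 2)"
      unfolding I by (simp add: sum_subtractf algebra_simps)
    then have "\<bar>(\<Sum>j<n. g (?a j)) - real n * integral {0..1} g\<bar> =
      real n * \<bar>\<Sum>j<n. integral {?a j..?a (Suc j)} g - (1 / real n) * (g (?a j) + g (?a (Suc j))) / 2\<bar>"
      by (simp add: abs_mult)
    also have "\<dots> \<le> real n * (\<Sum>j<n. C * (1 / real n) ^ 3 / 2)"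
    proof (intro mult_left_mono order_trans[OF sum_abs] sum_mono)
      fix j assume j: "j \<in> {..<n}"
      have "?a j + 1 / real n \<le> 1" unfolding step[symmetric] using j n by (simp add: field_simps)
      then show "\<bar>integral {?a j..?a (Suc j)} g - (1 / real n) * (g (?a j) + g (?a (Suc j))) / 2\<bar>
        \<le> C * (1 / real n) ^ 3 / 2"
        unfolding step
      proof (intro trapezoid_error[OF g g'] C)
        fix t assume "?a j \<le> t" "t \<le> ?a j + 1 / real n"
        moreover have "0 \<le> ?a j" by simp
        ultimately show "t \<in> {0..1}" using \<open>?a j + 1 / real n \<le> 1\<close> unfolding atLeastAtMost_iff by linarith
      qed simp
    qed auto
    also have "\<dots> = C / 2 * (1 / real n)" using n by (simp add: power3_eq_cube field_simps)
    finally show ?thesis .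
  qed
  have "(\<lambda>n. C / 2 * (1 / real n)) \<longlonglongrightarrow> C / 2 * 0"
    by (intro tendsto_mult tendsto_const lim_1_over_n)
  then have "(\<lambda>n. C / 2 * (1 / real n)) \<longlonglongrightarrow> 0" by simp
  then show ?thesis
    by (rule Lim_null_comparison[rotated])
      (use bound in \<open>auto intro!: eventually_sequentiallyI[of 1]\<close>)
qed

lemma cos_2pi_eq_1_iff: "cos (2 * pi * t) = 1 \<longleftrightarrow> t \<in> \<int>" for t :: real
proof -
  have "cos (2 * pi * t) = 1 \<longleftrightarrow> (\<exists>k::int. 2 * pi * t = of_int k * 2 * pi)" by (rule cos_one_2pi_int)
  also have "\<dots> \<longleftrightarrow> (\<exists>k::int. t = of_int k)" by simp
  finally show ?thesis by (auto simp: Ints_def)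
qed

lemma cos_2pi_less_1: "cos (2 * pi * t) < 1" if "0 < t" "t < 1" for t :: real
proof -
  have "t \<notin> \<int>" using that by (auto elim!: Ints_cases)
  then show ?thesis using cos_2pi_eq_1_iff[of t] cos_le_one[of "2 * pi * t"] by linarith
qed

text \<open>
  The logarithmic singularities at \<open>0\<close> and \<open>1\<close> are dominated by those of \<open>ln t\<close> and
  \<open>ln (1 - t)\<close>, because \<open>2 - 2 cos (2 \<pi> t) = (2 sin (\<pi> t))\<^sup>2 \<ge> (4 t (1 - t))\<^sup>2\<close>.
\<close>

lemma ln_chord_integrable: "(\<lambda>t. ln (2 - 2 * cos (2 * pi * t))) integrable_on {0..1 :: real}"
proof -
  let ?f = "\<lambda>t::real. ln (2 - 2 * cos (2 * pi * t))"
  \<comment> \<open>The antiderivative \<open>x ln x - x\<close> extends continuously to \<open>0\<close>.\<close>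
  have lnint: "(ln has_integral -1) {0..1 :: real}"
  proof -
    have "continuous (at x within {0..1}) (\<lambda>x::real. x * ln x - x)" if "x \<in> {0..1}" for x
    proof (cases "x = 0")
      case True
      have "((\<lambda>x::real. x * ln x - x) \<longlongrightarrow> 0) (at_right 0)" by real_asymp
      then show ?thesis using True
        by (simp add: continuous_within at_within_Icc_at_right)
    next
      case False
      then show ?thesis using that by (auto intro!: continuous_intros)
    qed
    then have c: "continuous_on {0..1} (\<lambda>x::real. x * ln x - x)"
      by (auto simp: continuous_on_eq_continuous_within)
    have "((\<lambda>x. ln x) has_integral (1 * ln 1 - 1) - (0 * ln 0 - 0)) {0..1 :: real}"
      by (rule fundamental_theorem_of_calculus_interior[OF _ c])
        (auto intro!: derivative_eq_intros simp: has_real_derivative_iff_has_vector_derivative[symmetric])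
    then show ?thesis by simp
  qed
  have lnint': "((\<lambda>t. ln (1 - t)) has_integral -1) {0..1 :: real}"
    using has_integral_affinity[OF lnint[folded cbox_interval], of "-1" 1] by simp
  have majorant: "(\<lambda>t. 4 * ln 4 - 2 * ln t - 2 * ln (1 - t)) integrable_on {0..1 :: real}"
    using has_integral_integrable[OF has_integral_cmul[OF lnint, of 2]]
      has_integral_integrable[OF has_integral_cmul[OF lnint', of 2]]
    by (intro integrable_diff) auto
  have measurable: "?f \<in> borel_measurable (lebesgue_on {0..1})"
  proof -
    have "?f \<in> borel_measurable lborel" by measurable
    then have "?f \<in> borel_measurable lebesgue" by (rule measurable_completion)
    then show ?thesis by (rule measurable_restrict_space1)
  qed
  have bound: "norm (?f t) \<le> 4 * ln 4 - 2 * ln t - 2 * ln (1 - t)" if t: "t \<in> {0..1}" for t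
  proof (cases "t = 0 \<or> t = 1")
    case False
    then have t: "0 < t" "t < 1" using t by auto
    \<comment> \<open>Jordan's inequality: the sine lies above its chord on \<open>[0, \<pi>/2]\<close>.\<close>
    have jordan: "2 * u \<le> sin (pi * u)" if "0 \<le> u" "u \<le> 1 / 2" for u
    proof -
      have "convex_on {0..pi / 2} (\<lambda>x. - sin x)"
        by (rule f''_ge0_imp_convex[where f' = "\<lambda>x. - cos x" and f'' = sin])
          (auto intro!: derivative_eq_intros sin_ge_zero)
      from convex_onD_Icc'[OF this, of "pi * u"] that show ?thesis by simp
    qed
    have "4 * t * (1 - t) \<le> 2 * sin (pi * t)"
    proof (cases "t \<le> 1 / 2")
      case True
      have "4 * t * (1 - t) \<le> 4 * t * 1" using t by (intro mult_left_mono) auto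
      also have "\<dots> \<le> 2 * sin (pi * t)" using jordan[of t] t True by simp
      finally show ?thesis .
    next
      case False
      have "sin (pi * (1 - t)) = sin (pi * t)" by (simp add: right_diff_distrib sin_diff)
      then have "4 * (1 - t) * 1 \<le> 2 * sin (pi * t)" using jordan[of "1 - t"] t False by simp
      moreover have "4 * (1 - t) * t \<le> 4 * (1 - t) * 1" using t by (intro mult_left_mono) auto
      ultimately show ?thesis by (simp only: mult_ac)
    qed
    then have "(4 * t * (1 - t))\<^sup>2 \<le> (2 * sin (pi * t))\<^sup>2" using t by (intro power_mono) auto
    also have "(2 * sin (pi * t))\<^sup>2 = 2 - 2 * cos (2 * pi * t)"
      using cos_double_sin[of "pi * t"] by (simp add: power_mult_distrib mult.assoc)
    finally have lower: "(4 * t * (1 - t))\<^sup>2 \<le> 2 - 2 * cos (2 * pi * t)" .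
    have pos: "0 < (4 * t * (1 - t))\<^sup>2" using t by simp
    have "0 < 2 - 2 * cos (2 * pi * t)" using lower pos by linarith
    then have "ln ((4 * t * (1 - t))\<^sup>2) \<le> ?f t" using lower pos by (simp only: ln_le_cancel_iff)
    moreover have "ln ((4 * t * (1 - t))\<^sup>2) = 2 * ln 4 + 2 * ln t + 2 * ln (1 - t)"
      using t by (simp add: ln_realpow ln_mult)
    moreover have "?f t \<le> ln 4"
    proof -
      have "2 - 2 * cos (2 * pi * t) \<le> 4" using cos_ge_minus_one[of "2 * pi * t"] by linarith
      moreover have "0 < 2 - 2 * cos (2 * pi * t)" using lower pos by linarith
      ultimately show ?thesis by simp
    qed
    moreover have "0 < ln (4 :: real)" "ln t \<le> 0" "ln (1 - t) \<le> 0" using t by auto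
    ultimately show ?thesis unfolding real_norm_def by linarith
  qed auto
  show ?thesis
    by (rule measurable_bounded_by_integrable_imp_integrable[OF measurable majorant bound]) auto
qed

text \<open>
  The integrand \<open>f\<close> satisfies \<open>f (2 t) = f t + f (t + 1/2)\<close>, since
  \<open>2 - 2 cos (2 x) = (2 - 2 cos x) (2 + 2 cos x)\<close>.  Integrating over \<open>[0, 1/2]\<close> gives \<open>I / 2 = I\<close>.
\<close>

lemma integral_ln_chord: "integral {0..1 :: real} (\<lambda>t. ln (2 - 2 * cos (2 * pi * t))) = 0"
proof -
  let ?f = "\<lambda>t::real. ln (2 - 2 * cos (2 * pi * t))"
  define I where "I = integral {0..1} ?f"
  have I: "(?f has_integral I) {0..1}"
    using ln_chord_integrable by (simp add: I_def integrable_integral)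
  have int: "?f integrable_on {a..b}" if "0 \<le> a" "b \<le> 1" for a b
    by (rule integrable_subinterval_real[OF ln_chord_integrable]) (use that in auto)
  have upper: "(?f has_integral integral {1/2..1} ?f) {1/2..1}"
    using int by (intro integrable_integral) auto
  have "((\<lambda>t. ?f (1 * t + 1/2)) has_integral integral {1/2..1} ?f) {0..1/2}"
    using has_integral_affinity[OF upper[folded cbox_interval], of 1 "1/2"] by simp
  then have "((\<lambda>t. ?f t + ?f (t + 1/2)) has_integral integral {0..1/2} ?f + integral {1/2..1} ?f) {0..1/2}"
    using int by (intro has_integral_add integrable_integral) auto
  moreover have "integral {0..1/2} ?f + integral {1/2..1} ?f = I"
    unfolding I_def by (rule Henstock_Kurzweil_Integration.integral_combine) (auto simp: ln_chord_integrable)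
  ultimately have sum: "((\<lambda>t. ?f t + ?f (t + 1/2)) has_integral I) {0..1/2}" by simp
  have "((\<lambda>t. ?f (2 * t + 0)) has_integral I / 2) {0..1/2}"
    using has_integral_affinity[OF I[folded cbox_interval], of 2 0] by simp
  then have "((\<lambda>t. ?f t + ?f (t + 1/2)) has_integral I / 2) {0..1/2}"
  \<comment> \<open>The functional equation fails where an argument of the logarithm is \<open>0\<close>, as \<open>ln 0 = 0\<close>.\<close>
  proof (rule has_integral_spike_finite[of "{0, 1/2}", rotated 2])
    fix t :: real assume "t \<in> {0..1/2} - {0, 1/2}"
    then have t: "0 < t" "t < 1/2" by auto
    have c: "cos (2 * pi * (t + 1/2)) = - cos (2 * pi * t)" by (simp add: distrib_left)
    have "2 - 2 * cos (2 * pi * (2 * t + 0)) = (2 - 2 * cos (2 * pi * t)) * (2 + 2 * cos (2 * pi * t))"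
      using cos_double_cos[of "2 * pi * t"] by (simp add: algebra_simps power2_eq_square)
    moreover have "cos (2 * pi * t) < 1" using t by (intro cos_2pi_less_1) auto
    moreover have "cos (2 * pi * (t + 1/2)) < 1" using t by (intro cos_2pi_less_1) auto
    ultimately show "?f t + ?f (t + 1/2) = ?f (2 * t + 0)" unfolding c
      by (simp add: ln_mult_pos)
  qed auto
  then have "I = I / 2" using sum by (rule has_integral_unique[rotated])
  then show ?thesis by (simp add: I_def)
qed

text \<open>
  The factors are the squares of the moduli of \<open>1 - \<omega>\<^sup>\<alpha>\<close> for \<open>\<omega> = cis (2 \<pi> / n)\<close>, and
  \<open>\<Prod>\<^bsub>\<alpha>=1..n-1\<^esub> (X - \<omega>\<^sup>\<alpha>) = 1 + X + \<dots> + X\<^bsup>n-1\<^esup>\<close> is evaluated at \<open>X = 1\<close>.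
\<close>

lemma prod_chord_lengths:
  assumes "0 < n"
  shows "(\<Prod>\<alpha> = 1..<n. 2 - 2 * cos (2 * pi * real \<alpha> / real n)) = real n ^ 2"
proof -
  let ?w = "\<lambda>\<alpha>. cis (2 * pi * real \<alpha> / real n)"
  define p q :: "complex poly"
    where "p = (\<Sum>k<n. monom 1 k)" and "q = (\<Prod>\<alpha> = 1..<n. [:- ?w \<alpha>, 1:])"
  have inj: "inj_on ?w {..<n}"
    using Complex.bij_betw_roots_unity[OF assms] by (auto simp: bij_betw_def)
  have deg_q: "degree q = n - 1" unfolding q_def by (subst degree_prod_eq_sum_degree) auto
  have coeff_p: "coeff p i = (if i < n then 1 else 0)" for i
    by (simp add: p_def coeff_sum)
  have "p = q"
  proof (rule poly_eqI_degree_lead_coeff[where A = "?w ` {1..<n}" and n = "n - 1"])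
    have "card (?w ` {1..<n}) = n - 1"
      using inj by (subst card_image) (auto elim!: inj_on_subset)
    then show "n - 1 \<le> card (?w ` {1..<n})" by simp
    have "lead_coeff q = 1" unfolding q_def lead_coeff_prod by simp
    then show "coeff p (n - 1) = coeff q (n - 1)" using coeff_p assms by (simp add: deg_q)
    show "degree p \<le> n - 1" using coeff_p by (intro degree_le) auto
    show "degree q \<le> n - 1" using deg_q by simp
    show "poly p x = poly q x" if x: "x \<in> ?w ` {1..<n}" for x
    proof -
      obtain \<alpha> where \<alpha>: "\<alpha> \<in> {1..<n}" "x = ?w \<alpha>" using x by blast
      have "x ^ n = 1" using assms cis_multiple_2pi[of "real \<alpha>"] \<alpha>(2) by (simp add: Complex.DeMoivre)
      moreover have "x \<noteq> 1" using inj_onD[OF inj, of \<alpha> 0] \<alpha> assms by auto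
      ultimately have "poly p x = 0"
        using geometric_sum[of x n] by (simp add: p_def poly_sum poly_monom)
      moreover have "poly q x = 0" unfolding q_def poly_prod using \<alpha> by (intro prod_zero) auto
      ultimately show ?thesis by simp
    qed
  qed
  then have "of_nat n = (\<Prod>\<alpha> = 1..<n. 1 - ?w \<alpha>)"
  proof -
    have "poly p 1 = of_nat n" by (simp add: p_def poly_sum poly_monom)
    moreover have "poly q 1 = (\<Prod>\<alpha> = 1..<n. 1 - ?w \<alpha>)" by (simp add: q_def poly_prod)
    ultimately show ?thesis using \<open>p = q\<close> by simp
  qed
  then have "norm (of_nat n :: complex) = (\<Prod>\<alpha> = 1..<n. norm (1 - ?w \<alpha>))"
    by (simp only: prod_norm)
  then have "real n ^ 2 = (\<Prod>\<alpha> = 1..<n. norm (1 - ?w \<alpha>) ^ 2)"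
    unfolding prod_power_distrib[symmetric] by simp
  moreover have "norm (1 - cis \<theta>) ^ 2 = 2 - 2 * cos \<theta>" for \<theta>
    using sin_cos_squared_add2[of \<theta>] by (simp add: cmod_power2 power2_diff)
  ultimately show ?thesis by simp
qed

lemma riemann_sum_ln_poly:
  fixes R :: "real poly"
  assumes nz: "\<And>t. poly R (cos (2 * pi * t)) \<noteq> 0"
  shows "(\<lambda>n. (\<Sum>j<n. ln \<bar>poly R (cos (2 * pi * (real j / real n)))\<bar>) -
    real n * integral {0..1} (\<lambda>t. ln \<bar>poly R (cos (2 * pi * t))\<bar>)) \<longlonglongrightarrow> 0"
proof -
  define c where "c = (\<lambda>t::real. cos (2 * pi * t))"
  define c' where "c' = (\<lambda>t::real. - (2 * pi * sin (2 * pi * t)))"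
  define P where "P = (\<lambda>t. poly R (c t))"
  define P' where "P' = (\<lambda>t. poly (pderiv R) (c t) * c' t)"
  define P'' where "P'' = (\<lambda>t. poly (pderiv (pderiv R)) (c t) * c' t * c' t +
    poly (pderiv R) (c t) * - (2 * pi * 2 * pi * c t))"
  have c: "(c has_real_derivative c' t) (at t)" for t
    unfolding c_def c'_def by (auto intro!: derivative_eq_intros)
  have c': "(c' has_real_derivative - (2 * pi * 2 * pi * c t)) (at t)" for t
    unfolding c_def c'_def by (auto intro!: derivative_eq_intros)
  have pc: "((\<lambda>t. poly S (c t)) has_real_derivative poly (pderiv S) (c t) * c' t) (at t)" for S t
    by (rule DERIV_chain'[OF c poly_DERIV])
  have P: "(P has_real_derivative P' t) (at t)" for t unfolding P_def P'_def by (rule pc)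
  have P': "(P' has_real_derivative P'' t) (at t)" for t
    unfolding P'_def P''_def by (rule derivative_eq_intros pc c' | simp)+
  have P0: "P t \<noteq> 0" for t using nz by (simp add: P_def c_def)
  \<comment> \<open>Writing \<open>ln \<bar>P\<bar>\<close> as \<open>ln (P\<^sup>2) / 2\<close> gives its derivative whatever the sign of \<open>P\<close>.\<close>
  have ln_abs: "ln \<bar>P t\<bar> = ln ((P t)\<^sup>2) / 2" for t
    using P0[of t] ln_realpow[of "\<bar>P t\<bar>" 2] by simp
  have "((\<lambda>t. ln ((P t)\<^sup>2) / 2) has_real_derivative P' t / P t) (at t)" for t
    by (auto intro!: derivative_eq_intros P P0 simp: P0) (simp add: power2_eq_square P0)
  then have g: "((\<lambda>t. ln \<bar>P t\<bar>) has_real_derivative P' t / P t) (at t)" for t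
    by (simp only: ln_abs)
  have g': "((\<lambda>t. P' t / P t) has_real_derivative (P'' t * P t - P' t * P' t) / (P t * P t)) (at t)" for t
    by (rule DERIV_divide[OF P' P P0])
  have "continuous_on {0..1} (\<lambda>t. (P'' t * P t - P' t * P' t) / (P t * P t))"
    unfolding P''_def P'_def P_def c_def c'_def
    using nz by (intro continuous_intros) auto
  from periodic_riemann_sum[OF g g' this] show ?thesis
    by (simp add: P_def c_def)
qed

section \<open>The associated polynomial\<close>

lemma poly_det_of: "poly (det_of n g) x = det_of n (\<lambda>i j. poly (g i j) x)"
  by (simp add: det_of_leibniz poly_sum poly_prod sign_def)

lemma pderiv_sum: "pderiv (\<Sum>x\<in>S. f x) = (\<Sum>x\<in>S. pderiv (f x))"
  using higher_pderiv_sum[of 1 f S] by simp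

text \<open>
  Jacobi's formula for a matrix whose entries off the diagonal are constant: only the
  permutations that fix \<open>i\<close> contribute to the derivative of the factor in row \<open>i\<close>.
\<close>

lemma pderiv_det_of:
  fixes g :: "nat \<Rightarrow> nat \<Rightarrow> real poly"
  assumes off: "\<And>i j. i < n \<Longrightarrow> j < n \<Longrightarrow> i \<noteq> j \<Longrightarrow> pderiv (g i j) = 0"
  shows "poly (pderiv (det_of n g)) x =
    (\<Sum>i<n. poly (pderiv (g i i)) x * det_of n (pin {i} (\<lambda>i j. poly (g i j) x)))"
proof -
  let ?h = "\<lambda>i j. poly (g i j) x"
  have perm: "poly (pderiv (\<Prod>i<n. g i (p i))) x =
    (\<Sum>i<n. poly (pderiv (g i i)) x * (\<Prod>j<n. pin {i} ?h j (p j)))"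
    if p: "p permutes {..<n}" for p
  proof -
    have "poly (pderiv (\<Prod>i<n. g i (p i))) x =
      (\<Sum>i<n. (\<Prod>j\<in>{..<n} - {i}. ?h j (p j)) * poly (pderiv (g i (p i))) x)"
      by (simp add: pderiv_prod poly_sum poly_prod)
    also have "\<dots> = (\<Sum>i<n. poly (pderiv (g i i)) x * (\<Prod>j<n. pin {i} ?h j (p j)))"
    proof (intro sum.cong refl)
      fix i assume i: "i \<in> {..<n}"
      then have "p i < n" using permutes_in_image[OF p, of i] by simp
      then show "(\<Prod>j\<in>{..<n} - {i}. ?h j (p j)) * poly (pderiv (g i (p i))) x =
        poly (pderiv (g i i)) x * (\<Prod>j<n. pin {i} ?h j (p j))"
        using i off[of i "p i"] by (simp add: prod_pin[OF p])
    qed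
    finally show ?thesis .
  qed
  have sgn: "pderiv (signof p * r) = signof p * pderiv r" for p and r :: "real poly"
    by (simp add: sign_def pderiv_minus)
  have "poly (pderiv (det_of n g)) x =
    (\<Sum>p | p permutes {..<n}. signof p * poly (pderiv (\<Prod>i<n. g i (p i))) x)"
    unfolding det_of_leibniz pderiv_sum poly_sum
    by (intro sum.cong refl, subst sgn) (simp add: sign_def)
  also have "\<dots> = (\<Sum>p | p permutes {..<n}. \<Sum>i<n.
      poly (pderiv (g i i)) x * (signof p * (\<Prod>j<n. pin {i} ?h j (p j))))"
    by (intro sum.cong refl) (simp add: perm sum_distrib_left mult.left_commute)
  also have "\<dots> = (\<Sum>i<n. poly (pderiv (g i i)) x * det_of n (pin {i} ?h))"
    unfolding det_of_leibniz sum_distrib_left by (rule sum.swap)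
  finally show ?thesis .
qed

lemma poly_eq_on_Icc:
  fixes p p' :: "real poly"
  assumes "\<And>w. w \<in> {-1..1} \<Longrightarrow> poly p w = poly p' w"
  shows "p = p'"
proof (rule ccontr)
  assume "p \<noteq> p'"
  then have "finite {w. poly (p - p') w = 0}" by (intro poly_roots_finite) simp
  moreover have "{-1..1} \<subseteq> {w. poly (p - p') w = 0}" using assms by auto
  ultimately have "finite {-1..1 :: real}" by (rule rev_finite_subset)
  then show False by (simp add: infinite_Icc)
qed

lemma chebyshev_0: "chebyshev 0 = 1"
  by (rule poly_eq_on_Icc) (simp add: poly_chebyshev)

lemma chebyshev_1: "chebyshev (Suc 0) = [:0, 1:]"
  by (rule poly_eq_on_Icc) (simp add: poly_chebyshev)

lemma chebyshev_Suc_Suc: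
  "chebyshev (Suc (Suc k)) = [:0, 2:] * chebyshev (Suc k) - chebyshev k"
proof (rule poly_eq_on_Icc)
  fix w :: real assume w: "w \<in> {-1..1}"
  define x where "x = arccos w"
  define y where "y = real (Suc k) * x"
  have x: "cos x = w" using w by (simp add: x_def)
  have "cos (y + x) + cos (y - x) = 2 * w * cos y"
    using x by (simp add: cos_add cos_diff)
  moreover have "y + x = real (Suc (Suc k)) * x" "y - x = real k * x"
    by (simp_all add: y_def algebra_simps)
  ultimately show "poly (chebyshev (Suc (Suc k))) w = poly ([:0, 2:] * chebyshev (Suc k) - chebyshev k) w"
    by (simp add: poly_chebyshev[OF w] y_def flip: x_def)
qed

lemma poly_chebyshev_1: "poly (chebyshev k) 1 = 1"
  by (simp add: poly_chebyshev)

lemma pderiv_chebyshev_1: "poly (pderiv (chebyshev k)) 1 = real k ^ 2"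
proof (induction k rule: induct_nat_012)
  case (ge2 k)
  then show ?case
    by (simp add: chebyshev_Suc_Suc pderiv_diff pderiv_mult pderiv_pCons pderiv_smult poly_chebyshev_1
        power2_eq_square algebra_simps)
qed (simp_all add: chebyshev_0 chebyshev_1 pderiv_pCons)

lemma poly_chebyshev_cos: "poly (chebyshev k) (cos \<theta>) = cos (real k * \<theta>)"
proof (induction k rule: induct_nat_012)
  case (ge2 k)
  have "real (Suc (Suc k)) * \<theta> = real (Suc k) * \<theta> + \<theta>" "real k * \<theta> = real (Suc k) * \<theta> - \<theta>"
    by (simp_all add: algebra_simps)
  then have "cos (real (Suc (Suc k)) * \<theta>) = 2 * cos \<theta> * cos (real (Suc k) * \<theta>) - cos (real k * \<theta>)"
    by (simp only: cos_add cos_diff) simp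
  then show ?case using ge2 by (simp add: chebyshev_Suc_Suc mult_ac)
qed (simp_all add: chebyshev_0 chebyshev_1)

lemma laplacian_eq_degree_minus_edge_mult:
  assumes H: "finite_loopfree H" and i: "i \<in> verts H" and j: "j \<in> verts H"
  shows "(laplacian H (edges H) i j :: 'a :: comm_ring_1) =
    (if i = j then of_nat (mg_degree H i) else 0) - of_nat (edge_mult H i j)"
proof (cases "i = j")
  case True
  have "edge_mult H i i = 0"
  proof -
    have "{e \<in> edges H. ends H e = {i, i}} = {}" using card_ends[OF H] by fastforce
    then show ?thesis unfolding edge_mult_def by (simp only: card.empty)
  qed
  have "mg_degree H i = (\<Sum>v\<in>verts H. \<Sum>e\<in>edges H. of_bool (ends H e = {i, v}))"
    using finite_graph(2)[OF H] by (simp add: mg_degree_def edge_mult_def Int_def)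
  also have "\<dots> = (\<Sum>e\<in>edges H. \<Sum>v\<in>verts H. of_bool (ends H e = {i, v}))" by (rule sum.swap)
  also have "\<dots> = (\<Sum>e\<in>edges H. of_bool (i \<in> ends H e))"
  proof (intro sum.cong refl)
    fix e assume e: "e \<in> edges H"
    show "(\<Sum>v\<in>verts H. of_bool (ends H e = {i, v})) = (of_bool (i \<in> ends H e) :: nat)"
    proof (cases "i \<in> ends H e")
      case True
      then obtain w where w: "ends H e = {i, w}" "w \<noteq> i"
        using card_ends[OF H e] unfolding card_2_iff by (metis insert_commute insertE singletonD)
      then have "w \<in> verts H" using ends_subset[OF H e] by auto
      moreover have "ends H e = {i, v} \<longleftrightarrow> v = w" for v using w by (auto simp: doubleton_eq_iff)
      ultimately show ?thesis using True finite_graph(1)[OF H] by (simp add: of_bool_def)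
    next
      case False
      then have "ends H e \<noteq> {i, v}" for v by auto
      then show ?thesis using False by simp
    qed
  qed
  finally have "(of_nat (mg_degree H i) :: 'a) = (\<Sum>e\<in>edges H. if i \<in> ends H e then 1 else 0)"
    by (simp add: of_nat_sum of_bool_def if_distrib[of of_nat] cong: if_cong)
  then show ?thesis using True \<open>edge_mult H i i = 0\<close> by (simp add: laplacian_def)
next
  case False
  have "i \<in> ends H e \<and> j \<in> ends H e \<longleftrightarrow> ends H e = {i, j}" if "e \<in> edges H" for e
    using card_ends[OF H that] False unfolding card_2_iff by auto
  then have "(laplacian H (edges H) i j :: 'a) = (\<Sum>e\<in>edges H. - of_bool (ends H e = {i, j}))"
    using False unfolding laplacian_def by (intro sum.cong) auto
  then show ?thesis using False finite_graph(2)[OF H] by (simp add: edge_mult_def sum_negf Int_def)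
qed

text \<open>
  The entries of the matrix whose determinant defines \<open>Q\<close>; only those on the diagonal depend on
  the variable.
\<close>

definition foliation_entry :: "(nat, 'e) multigraph \<Rightarrow> (nat \<Rightarrow> nat) \<Rightarrow> (nat \<Rightarrow> nat \<Rightarrow> nat) \<Rightarrow> nat \<Rightarrow> nat \<Rightarrow> real poly" where
  "foliation_entry H k s i j = (if i = j then foliation_weight H k s i else 0) - of_nat (edge_mult H i j)"

lemma foliation_poly_eq_det_of: "foliation_poly m H k s = det_of m (foliation_entry H k s)"
  unfolding foliation_poly_def det_of_def
  by (intro arg_cong[of _ _ Determinant.det] eq_matI)
    (auto simp: adjacency_matrix_def foliation_entry_def mat_diag_def)

lemma poly_of_nat_eq: "poly (of_nat n) x = (of_nat n :: real)"
  by (simp add: of_nat_poly)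

lemma poly_foliation_entry_cos:
  assumes H: "finite_loopfree H" and VH: "verts H = {..<m}" and "i < m" "j < m"
  shows "poly (foliation_entry H k s i j) (cos \<theta>) = symbol_matrix H k s \<theta> i j"
  using assms laplacian_eq_degree_minus_edge_mult[OF H, of i j, where 'a = real]
  by (auto simp: foliation_entry_def foliation_weight_def symbol_matrix_def poly_sum poly_chebyshev_cos
      sum_subtractf poly_of_nat_eq sum_distrib_left)

lemma poly_foliation_poly_cos:
  assumes "finite_loopfree H" "verts H = {..<m}"
  shows "poly (foliation_poly m H k s) (cos \<theta>) = det_of m (symbol_matrix H k s \<theta>)"
  unfolding foliation_poly_eq_det_of poly_det_of
  by (intro det_of_cong poly_foliation_entry_cos[OF assms])

text \<open>
  At \<open>w = 1\<close> the matrix is the Laplacian of \<open>H\<close>, so by the matrix-tree theorem all minors in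
  Jacobi's formula are equal to the number of spanning trees of \<open>H\<close>.
\<close>

lemma pderiv_foliation_poly_1:
  assumes H: "finite_loopfree H" and VH: "verts H = {..<m}"
  shows "poly (pderiv (foliation_poly m H k s)) 1 =
    - 2 * (\<Sum>i<m. \<Sum>p = 1..k i. real (s i p) ^ 2) * real (num_spanning_trees H)"
proof -
  have d_nat: "pderiv (of_nat n :: real poly) = 0" for n by (simp add: of_nat_poly)
  have diag: "poly (pderiv (foliation_entry H k s i i)) 1 = - 2 * (\<Sum>p = 1..k i. real (s i p) ^ 2)" for i
  proof -
    have "pderiv (2 * chebyshev j) = 2 * pderiv (chebyshev j)" for j
      using d_nat[of 2] by (simp add: pderiv_mult)
    then have "pderiv (foliation_entry H k s i i) = - (\<Sum>p = 1..k i. 2 * pderiv (chebyshev (s i p)))"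
      unfolding foliation_entry_def foliation_weight_def
      by (simp only: if_True refl pderiv_diff d_nat pderiv_sum diff_zero diff_0)
    then show ?thesis by (simp add: poly_sum pderiv_chebyshev_1 sum_distrib_left sum_negf)
  qed
  have tree: "det_of m (pin {i} (\<lambda>i j. poly (foliation_entry H k s i j) 1)) = real (num_spanning_trees H)"
    if i: "i < m" for i
  proof -
    have "poly (foliation_entry H k s u v) 1 = laplacian H (edges H) u v" if "u < m" "v < m" for u v
      using poly_foliation_entry_cos[OF H VH that, of k s 0] by (simp add: symbol_matrix_def)
    then have "det_of m (pin {i} (\<lambda>i j. poly (foliation_entry H k s i j) 1)) =
      det_of m (pin {i} (\<lambda>i j. laplacian H (edges H) (id i) (id j)))"
      by (intro det_of_cong) (auto simp: pin_def)
    then show ?thesis using matrix_tree[OF H _ i, of id] VH by (simp add: bij_betw_id)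
  qed
  have "poly (pderiv (foliation_poly m H k s)) 1 = (\<Sum>i<m. poly (pderiv (foliation_entry H k s i i)) 1 *
      det_of m (pin {i} (\<lambda>i j. poly (foliation_entry H k s i j) 1)))"
    unfolding foliation_poly_eq_det_of
    by (rule pderiv_det_of) (simp add: foliation_entry_def d_nat pderiv_minus)
  also have "\<dots> = (\<Sum>i<m. - 2 * (\<Sum>p = 1..k i. real (s i p) ^ 2) * real (num_spanning_trees H))"
    by (intro sum.cong refl) (simp add: diag tree)
  finally show ?thesis by (simp only: sum_distrib_left sum_distrib_right)
qed

lemma foliation_poly_at_1:
  assumes H: "finite_loopfree H" and VH: "verts H = {..<m}" and m: "0 < m"
  shows "poly (foliation_poly m H k s) 1 = 0"
proof -
  have "(\<Sum>j<m. symbol_matrix H k s 0 i j * 1) = 0" for i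
  proof -
    have "symbol_matrix H k s 0 i j = laplacian H (edges H) i j" for j
      by (simp add: symbol_matrix_def)
    moreover have "(\<Sum>j\<in>verts H. laplacian H (edges H) i j) = (0 :: real)"
      by (rule laplacian_row_sum[OF H order_refl])
    ultimately show ?thesis using VH by simp
  qed
  then have "det_of m (symbol_matrix H k s 0) = 0"
    using m by (subst det_of_eq_0_iff) (intro exI[of _ "\<lambda>_. 1"], auto)
  then show ?thesis using poly_foliation_poly_cos[OF H VH, of k s 0] by simp
qed

lemma laplacian_quadratic_form:
  fixes x :: "'v \<Rightarrow> real"
  assumes G: "finite_loopfree G"
  shows "(\<Sum>u\<in>verts G. x u * (\<Sum>v\<in>verts G. laplacian G (edges G) u v * x v)) =
    (\<Sum>e\<in>edges G. (\<Sum>u\<in>ends G e. \<Sum>v\<in>ends G e. (x u - x v)\<^sup>2) / 2)"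
proof -
  have "(\<Sum>u\<in>verts G. x u * (\<Sum>v\<in>verts G. laplacian G (edges G) u v * x v)) =
    (\<Sum>u\<in>verts G. x u * (\<Sum>e\<in>edges G. if u \<in> ends G e then \<Sum>v\<in>ends G e. x u - x v else 0))"
    by (subst laplacian_apply[OF G order_refl finite_graph(1)[OF G] order_refl]) (rule refl)
  also have "\<dots> = (\<Sum>e\<in>edges G. \<Sum>u\<in>verts G. if u \<in> ends G e then x u * (\<Sum>v\<in>ends G e. x u - x v) else 0)"
    by (subst sum.swap) (auto simp: sum_distrib_left intro!: sum.cong)
  also have "\<dots> = (\<Sum>e\<in>edges G. (\<Sum>u\<in>ends G e. \<Sum>v\<in>ends G e. (x u - x v)\<^sup>2) / 2)"
  proof (intro sum.cong refl)
    fix e assume e: "e \<in> edges G"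
    then obtain a b where ab: "ends G e = {a, b}" "a \<noteq> b"
      using card_ends[OF G e] by (auto simp: card_2_iff)
    have "(\<Sum>u\<in>verts G. if u \<in> ends G e then x u * (\<Sum>v\<in>ends G e. x u - x v) else 0) =
      (\<Sum>u\<in>ends G e. x u * (\<Sum>v\<in>ends G e. x u - x v))"
      using ends_subset[OF G e] finite_graph(1)[OF G] by (intro sum.mono_neutral_cong_right) auto
    also have "\<dots> = (\<Sum>u\<in>ends G e. \<Sum>v\<in>ends G e. (x u - x v)\<^sup>2) / 2"
      using ab by (simp add: power2_eq_square algebra_simps)
    finally show "(\<Sum>u\<in>verts G. if u \<in> ends G e then x u * (\<Sum>v\<in>ends G e. x u - x v) else 0) =
      (\<Sum>u\<in>ends G e. \<Sum>v\<in>ends G e. (x u - x v)\<^sup>2) / 2" .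
  qed
  finally show ?thesis .
qed

text \<open>
  For a kernel vector \<open>x\<close>, the quadratic form \<open>\<Sum>\<^sub>e (x\<^sub>u - x\<^sub>v)\<^sup>2 + \<Sum>\<^sub>i c\<^sub>i x\<^sub>i\<^sup>2\<close> vanishes.  The
  first sum makes \<open>x\<close> constant on the connected graph, the second makes this constant zero.
\<close>

lemma det_laplacian_plus_diag_nonzero:
  fixes c :: "nat \<Rightarrow> real"
  assumes G: "finite_loopfree G" and con: "mg_connected G" and VG: "verts G = {..<m}"
    and c: "\<And>i. i < m \<Longrightarrow> 0 \<le> c i" and pos: "r < m" "0 < c r"
  shows "det_of m (\<lambda>i j. laplacian G (edges G) i j + (if i = j then c i else 0)) \<noteq> 0"
proof
  assume "det_of m (\<lambda>i j. laplacian G (edges G) i j + (if i = j then c i else 0)) = 0"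
  then obtain x where x: "\<exists>i<m. x i \<noteq> 0"
    "\<And>i. i < m \<Longrightarrow> (\<Sum>j<m. (laplacian G (edges G) i j + (if i = j then c i else 0)) * x j) = 0"
    unfolding det_of_eq_0_iff by blast
  let ?D = "\<lambda>e. (\<Sum>u\<in>ends G e. \<Sum>v\<in>ends G e. (x u - x v)\<^sup>2) / 2"
  have "(\<Sum>j<m. laplacian G (edges G) i j * x j) + c i * x i = 0" if "i < m" for i
  proof -
    have "(\<Sum>j<m. (if i = j then c i else 0) * x j) = (\<Sum>j<m. if i = j then c i * x j else 0)"
      by (intro sum.cong) auto
    then show ?thesis using x(2)[OF that] that by (simp add: distrib_right sum.distrib)
  qed
  then have "0 = (\<Sum>i<m. x i * ((\<Sum>j<m. laplacian G (edges G) i j * x j) + c i * x i))" by simp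
  also have "\<dots> = (\<Sum>e\<in>edges G. ?D e) + (\<Sum>i<m. c i * (x i)\<^sup>2)"
    using laplacian_quadratic_form[OF G, of x]
    by (simp add: VG distrib_left sum.distrib power2_eq_square mult_ac)
  finally have sum0: "(\<Sum>e\<in>edges G. ?D e) + (\<Sum>i<m. c i * (x i)\<^sup>2) = 0" by simp
  have D0: "0 \<le> ?D e" for e by (simp add: sum_nonneg)
  have "0 \<le> (\<Sum>e\<in>edges G. ?D e)" by (rule sum_nonneg) (rule D0)
  moreover have "0 \<le> (\<Sum>i<m. c i * (x i)\<^sup>2)" by (rule sum_nonneg) (simp add: c)
  ultimately have E: "(\<Sum>e\<in>edges G. ?D e) = 0" and C: "(\<Sum>i<m. c i * (x i)\<^sup>2) = 0"
    using sum0 by linarith+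
  have adj: "x u = x v" if uv: "(u, v) \<in> adjacency G" for u v
  proof -
    obtain e where e: "e \<in> edges G" "ends G e = {u, v}" using uv by (auto simp: adjacency_def)
    have "?D e = 0" by (rule sum_nonneg_0[OF finite_graph(2)[OF G] D0 E e(1)])
    moreover have "?D e = (x u - x v)\<^sup>2" if "u \<noteq> v"
      unfolding e(2) using that by (simp add: power2_commute[of "x v" "x u"])
    ultimately show ?thesis by (cases "u = v") simp_all
  qed
  have const: "x v = x r" if "v < m" for v
  proof -
    have "(r, v) \<in> (adjacency G)\<^sup>*" using con that pos VG by (auto simp: mg_connected_def)
    then show ?thesis by (induction rule: rtrancl_induct) (auto dest: adj)
  qed
  have "c r * (x r)\<^sup>2 = 0"
    by (rule sum_nonneg_0[OF finite_lessThan _ C]) (use c pos(1) in auto)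
  then have "x r = 0" using pos by simp
  then show False using x(1) const by auto
qed

text \<open>
  The least positive \<open>d\<close> with \<open>d t\<close> an integer divides every such number, by division with
  remainder.
\<close>

lemma Ints_mult_Gcd:
  fixes S :: "nat set" and t :: real
  assumes "\<And>z. z \<in> S \<Longrightarrow> real z * t \<in> \<int>" and "Gcd S = 1"
  shows "t \<in> \<int>"
proof -
  have "\<exists>z. z \<in> S \<and> z \<noteq> 0" using assms(2) by (metis Gcd_0_iff one_neq_zero singletonI subsetI)
  then have ex: "\<exists>d. 0 < d \<and> real d * t \<in> \<int>" using assms(1) by blast
  define d where "d = (LEAST d. 0 < d \<and> real d * t \<in> \<int>)"
  have d: "0 < d" "real d * t \<in> \<int>" using LeastI_ex[OF ex] by (simp_all add: d_def)
  have "d dvd z" if "z \<in> S" for z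
  proof (rule ccontr)
    assume "\<not> d dvd z"
    then have "0 < z mod d" by (simp add: mod_greater_zero_iff_not_dvd)
    have "real z * t = real (z div d) * (real d * t) + real (z mod d) * t"
      by (metis distrib_right div_mult_mod_eq mult.assoc of_nat_add of_nat_mult)
    then have "real (z mod d) * t = real z * t - real (z div d) * (real d * t)" by simp
    also have "\<dots> \<in> \<int>"
      by (rule Ints_diff[OF assms(1)[OF that] Ints_mult[OF Ints_of_nat d(2)]])
    finally have "d \<le> z mod d" unfolding d_def using \<open>0 < z mod d\<close> by (intro Least_le) (auto simp: d_def)
    then show False using mod_less_divisor[OF d(1), of z] by linarith
  qed
  then have "d dvd Gcd S" by (rule Gcd_greatest)
  then show ?thesis using d assms(2) by simp
qed

text \<open>
  This is where the condition on the greatest common divisor enters: it excludes that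
  \<open>2 - 2 cos (2 \<pi> s\<^sub>i\<^sub>p t)\<close> vanishes for all \<open>i\<close> and \<open>p\<close>.
\<close>

lemma foliation_poly_cos_nonzero:
  assumes H: "finite_loopfree H" and con: "mg_connected H" and VH: "verts H = {..<m}"
    and gcd: "Gcd {s i p |i p. i < m \<and> p \<in> {1..k i}} = 1" and t: "t \<notin> \<int>"
  shows "poly (foliation_poly m H k s) (cos (2 * pi * t)) \<noteq> 0"
proof -
  define c where "c = (\<lambda>i. \<Sum>p = 1..k i. 2 - 2 * cos (real (s i p) * (2 * pi * t)))"
  have nonneg: "0 \<le> 2 - 2 * cos y" for y :: real using cos_le_one[of y] by linarith
  obtain i p where ip: "i < m" "p \<in> {1..k i}" "real (s i p) * t \<notin> \<int>"
    using Ints_mult_Gcd[OF _ gcd, of t] t by auto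
  have "2 * pi * (real (s i p) * t) = real (s i p) * (2 * pi * t)" by simp
  then have "cos (real (s i p) * (2 * pi * t)) \<noteq> 1"
    using ip(3) cos_2pi_eq_1_iff[of "real (s i p) * t"] by metis
  then have "0 < 2 - 2 * cos (real (s i p) * (2 * pi * t))"
    using cos_le_one[of "real (s i p) * (2 * pi * t)"] by linarith
  then have "0 < c i" unfolding c_def using ip nonneg by (intro sum_pos2[of _ p]) auto
  moreover have "0 \<le> c j" for j unfolding c_def by (intro sum_nonneg nonneg)
  ultimately have "det_of m (\<lambda>i j. laplacian H (edges H) i j + (if i = j then c i else 0)) \<noteq> 0"
    using ip by (intro det_laplacian_plus_diag_nonzero[OF H con VH, where r = i]) auto
  then show ?thesis
    unfolding poly_foliation_poly_cos[OF H VH] symbol_matrix_def[abs_def] c_def .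
qed

section \<open>Asymptotics\<close>

text \<open>
  The count is exact for every admissible \<open>n\<close>; the error term \<open>\<epsilon> n\<close> is \<open>n\<close> times the difference
  between a Riemann sum and the integral of \<open>ln \<bar>R (cos 2 \<pi> t)\<bar>\<close>, where \<open>Q(w) = (2 - 2 w) R(w)\<close>.  Since the number
  of spanning trees is not negative, the product formula may be used with absolute values,
  which avoids determining the sign of \<open>R\<close> on \<open>[-1, 1]\<close>.
\<close>

lemma num_spanning_trees_asymptotics:
  fixes H :: "(nat, 'e) multigraph"
  assumes H: "finite_loopfree H" and con: "mg_connected H" and VH: "verts H = {..<m}"
    and s_pos: "\<forall>i<m. \<forall>p\<in>{1..k i}. 1 \<le> s i p"
    and gcd: "Gcd {s i p |i p. i < m \<and> p \<in> {1..k i}} = 1"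
  defines "Q \<equiv> foliation_poly m H k s"
    and "q \<equiv> \<Sum>i<m. \<Sum>j = 1..k i. real (s i j) ^ 2"
  shows "\<exists>\<epsilon>. \<epsilon> \<longlonglongrightarrow> 0 \<and> (\<forall>n>0. (\<forall>i<m. \<forall>p\<in>{1..k i}. 2 * s i p \<le> n) \<longrightarrow>
      real (num_spanning_trees (foliation n H (\<lambda>i. circulant n (k i) (s i)))) =
      real n / q * exp (integral {0..1} (\<lambda>t. ln \<bar>poly Q (cos (2 * pi * t))\<bar>)) ^ n * exp (\<epsilon> n))"
    and "0 < q"
proof -
  show q: "0 < q"
  proof -
    have "{s i p |i p. i < m \<and> p \<in> {1..k i}} \<noteq> {}" using gcd by (metis Gcd_empty zero_neq_one)
    then obtain i p where ip: "i < m" "p \<in> {1..k i}" by blast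
    then have "0 < real (s i p) ^ 2" using s_pos ip by fastforce
    then have "0 < (\<Sum>j = 1..k i. real (s i j) ^ 2)" using ip by (intro sum_pos2[of _ p]) auto
    then show ?thesis unfolding q_def
      using ip by (auto intro!: sum_pos2[of "{..<m}" i] sum_nonneg)
  qed
  define \<kappa> where "\<kappa> = real (num_spanning_trees H)"
  have m: "0 < m" using con VH by (auto simp: mg_connected_def intro: Nat.gr0I)
  have \<kappa>: "0 < \<kappa>" using num_spanning_trees_pos[OF H con] by (simp add: \<kappa>_def)
  have "poly Q 1 = 0" unfolding Q_def by (rule foliation_poly_at_1[OF H VH m])
  then obtain S where "Q = [:- 1, 1:] * S" using poly_eq_0_iff_dvd[of Q 1] by (auto elim: dvdE)
  \<comment> \<open>The factor \<open>2 - 2 w\<close> instead of \<open>w - 1\<close> is chosen because it becomes the squared chord length.\<close>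
  define R where "R = Polynomial.smult (- 1 / 2) S"
  have QR: "Q = [:2, - 2:] * R"
  proof -
    have "[:2, - 2:] * R = Polynomial.smult (- 1 / 2) [:2, - 2:] * S"
      by (simp only: R_def mult_smult_left mult_smult_right)
    also have "Polynomial.smult (- 1 / 2) [:2, - 2:] = [:- 1, 1 :: real:]" by simp
    finally show ?thesis using \<open>Q = [:- 1, 1:] * S\<close> by simp
  qed
  have "poly (pderiv Q) 1 = - 2 * poly R 1"
    unfolding QR pderiv_mult by (simp add: pderiv_pCons)
  then have R1: "poly R 1 = q * \<kappa>"
    using pderiv_foliation_poly_1[OF H VH, of k s] by (simp add: Q_def q_def \<kappa>_def)
  have Rnz: "poly R (cos (2 * pi * t)) \<noteq> 0" for t
  proof (cases "t \<in> \<int>")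
    case True
    then have "cos (2 * pi * t) = 1" by (simp add: cos_2pi_eq_1_iff)
    then show ?thesis using R1 q \<kappa> by simp
  next
    case False
    then have "poly Q (cos (2 * pi * t)) \<noteq> 0"
      unfolding Q_def by (rule foliation_poly_cos_nonzero[OF H con VH gcd])
    then show ?thesis by (auto simp: QR)
  qed
  define g where "g = (\<lambda>t. ln \<bar>poly R (cos (2 * pi * t))\<bar>)"
  define \<epsilon> where "\<epsilon> = (\<lambda>n. (\<Sum>j<n. g (real j / real n)) - real n * integral {0..1} g)"
  have lim: "\<epsilon> \<longlonglongrightarrow> 0" unfolding \<epsilon>_def g_def using Rnz by (rule riemann_sum_ln_poly)
  have I: "integral {0..1} (\<lambda>t. ln \<bar>poly Q (cos (2 * pi * t))\<bar>) = integral {0..1} g"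
  proof -
    let ?f = "\<lambda>t. ln (2 - 2 * cos (2 * pi * t))"
    have f: "(?f has_integral 0) {0..1}"
      using integrable_integral[OF ln_chord_integrable] by (simp add: integral_ln_chord)
    have "continuous_on {0..1} g"
      unfolding g_def using Rnz by (intro continuous_intros) auto
    then have "(g has_integral integral {0..1} g) {0..1}"
      by (intro integrable_integral integrable_continuous_real)
    with f have "((\<lambda>t. ?f t + g t) has_integral 0 + integral {0..1} g) {0..1}"
      by (rule has_integral_add)
    then have "((\<lambda>t. ln \<bar>poly Q (cos (2 * pi * t))\<bar>) has_integral 0 + integral {0..1} g) {0..1}"
    \<comment> \<open>At the end points \<open>Q (cos 2 \<pi> t) = 0\<close>, and \<open>ln 0 = 0\<close> does not split as a sum.\<close>
    proof (rule has_integral_spike_finite[of "{0, 1}", rotated 2])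
      fix t :: real assume "t \<in> {0..1} - {0, 1}"
      then have c: "cos (2 * pi * t) < 1" by (intro cos_2pi_less_1) auto
      have "poly Q (cos (2 * pi * t)) = (2 - 2 * cos (2 * pi * t)) * poly R (cos (2 * pi * t))"
        by (simp add: QR algebra_simps)
      then have "\<bar>poly Q (cos (2 * pi * t))\<bar> = (2 - 2 * cos (2 * pi * t)) * \<bar>poly R (cos (2 * pi * t))\<bar>"
        using c by (simp add: abs_mult)
      then show "ln \<bar>poly Q (cos (2 * pi * t))\<bar> = ?f t + g t"
        using c Rnz[of t] by (simp add: g_def ln_mult_pos)
    qed auto
    then show ?thesis by (simp add: integral_unique)
  qed
  have count: "real (num_spanning_trees (foliation n H (\<lambda>i. circulant n (k i) (s i)))) =
      real n / q * exp (integral {0..1} (\<lambda>t. ln \<bar>poly Q (cos (2 * pi * t))\<bar>)) ^ n * exp (\<epsilon> n)"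
    if n: "0 < n" and s_le: "\<And>i p. i < m \<Longrightarrow> p \<in> {1..k i} \<Longrightarrow> 2 * s i p \<le> n" for n
  proof -
    define T where "T = real (num_spanning_trees (foliation n H (\<lambda>i. circulant n (k i) (s i))))"
    let ?c = "\<lambda>\<alpha>. cos (2 * pi * real \<alpha> / real n)"
    have "real n * T = \<kappa> * (\<Prod>\<alpha> = 1..<n. poly Q (?c \<alpha>))"
      unfolding T_def \<kappa>_def Q_def poly_foliation_poly_cos[OF H VH]
      using s_pos by (intro num_spanning_trees_foliation[OF H VH m _ s_le n]) auto
    also have "(\<Prod>\<alpha> = 1..<n. poly Q (?c \<alpha>)) = (\<Prod>\<alpha> = 1..<n. 2 - 2 * ?c \<alpha>) * (\<Prod>\<alpha> = 1..<n. poly R (?c \<alpha>))"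
      unfolding prod.distrib[symmetric] by (intro prod.cong refl) (simp add: QR algebra_simps)
    also have "(\<Prod>\<alpha> = 1..<n. 2 - 2 * ?c \<alpha>) = real n ^ 2" by (rule prod_chord_lengths[OF n])
    finally have "\<bar>real n * T\<bar> = \<bar>\<kappa> * (real n ^ 2 * (\<Prod>\<alpha> = 1..<n. poly R (?c \<alpha>)))\<bar>" by simp
    then have T: "T = \<kappa> * real n * (\<Prod>\<alpha> = 1..<n. \<bar>poly R (?c \<alpha>)\<bar>)"
      using n \<kappa> by (simp add: abs_mult abs_prod power2_eq_square T_def)
    have "exp (\<Sum>j<n. g (real j / real n)) = (\<Prod>j<n. \<bar>poly R (?c j)\<bar>)"
    proof -
      have "exp (g t) = \<bar>poly R (cos (2 * pi * t))\<bar>" for t using Rnz[of t] by (simp add: g_def)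
      then show ?thesis by (simp add: exp_sum)
    qed
    also have "\<dots> = \<bar>poly R (?c 0)\<bar> * (\<Prod>\<alpha> = 1..<n. \<bar>poly R (?c \<alpha>)\<bar>)"
      using n prod.atLeast_Suc_lessThan[of 0 n "\<lambda>\<alpha>. \<bar>poly R (?c \<alpha>)\<bar>"] by (simp add: atLeast0LessThan)
    also have "\<bar>poly R (?c 0)\<bar> = q * \<kappa>" using R1 q \<kappa> by simp
    finally have "T = real n / q * exp (\<Sum>j<n. g (real j / real n))"
      using T q \<kappa> by (simp add: field_simps)
    also have "(\<Sum>j<n. g (real j / real n)) = real n * integral {0..1} g + \<epsilon> n" by (simp add: \<epsilon>_def)
    finally show ?thesis unfolding T_def I exp_add exp_of_nat_mult by simp
  qed
  show "\<exists>\<epsilon>. \<epsilon> \<longlonglongrightarrow> 0 \<and> (\<forall>n>0. (\<forall>i<m. \<forall>p\<in>{1..k i}. 2 * s i p \<le> n) \<longrightarrow>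
      real (num_spanning_trees (foliation n H (\<lambda>i. circulant n (k i) (s i)))) =
      real n / q * exp (integral {0..1} (\<lambda>t. ln \<bar>poly Q (cos (2 * pi * t))\<bar>)) ^ n * exp (\<epsilon> n))"
    by (intro exI[of _ \<epsilon>] conjI lim allI impI count) auto
qed

theorem theorem6p1:
  fixes m :: nat
    and H :: "(nat, 'e) multigraph"
    and k :: "nat \<Rightarrow> nat"
    and s :: "nat \<Rightarrow> nat \<Rightarrow> nat"
    and \<tau> :: "nat \<Rightarrow> nat"
    and Q :: "real poly"
    and q A :: real
  assumes "finite_loopfree H" and "mg_connected H" and "verts H = {..<m}"
    and "\<forall>i<m. \<forall>p\<in>{1..k i}. 1 \<le> s i p"
    and "\<forall>i<m. strict_mono_on {1..k i} (s i)"
    and "Gcd {s i p |i p. i < m \<and> p \<in> {1..k i}} = 1"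
    and "\<forall>n>0. (\<forall>i<m. \<forall>p\<in>{1..k i}. real (s i p) \<le> real n / 2) \<longrightarrow>
           \<tau> n = num_spanning_trees (foliation n H (\<lambda>i. circulant n (k i) (s i)))"
    and "Q = foliation_poly m H k s"
    and "q = (\<Sum>i<m. \<Sum>j=1..k i. real (s i j) ^ 2)"
    and "A = exp (integral {0..1} (\<lambda>t. ln \<bar>poly Q (cos (2 * pi * t))\<bar>))"
  shows "(\<lambda>n. real (\<tau> n)) \<sim>[at_top] (\<lambda>n. real n / q * A ^ n)"
proof -
  note main = num_spanning_trees_asymptotics[OF assms(1-4,6), folded assms(8,9), folded assms(10)]
  obtain \<epsilon> where \<epsilon>: "\<epsilon> \<longlonglongrightarrow> 0"
    and count: "\<forall>n>0. (\<forall>i<m. \<forall>p\<in>{1..k i}. 2 * s i p \<le> n) \<longrightarrow>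
      real (num_spanning_trees (foliation n H (\<lambda>i. circulant n (k i) (s i)))) =
      real n / q * A ^ n * exp (\<epsilon> n)"
    using main(1) by (elim exE conjE)
  have q: "0 < q" by (rule main(2))
  \<comment> \<open>Beyond \<open>N\<close> all jumps are at most \<open>n / 2\<close>, so that \<open>\<tau>\<close> is specified; the successor makes
    \<open>n\<close> positive.\<close>
  define N where "N = Suc (\<Sum>i<m. \<Sum>p = 1..k i. 2 * s i p)"
  have s_le: "2 * s i p \<le> n" if "N \<le> n" "i < m" "p \<in> {1..k i}" for n i p
  proof -
    have "2 * s i p \<le> (\<Sum>p = 1..k i. 2 * s i p)" using that by (intro member_le_sum) auto
    also have "\<dots> \<le> (\<Sum>i<m. \<Sum>p = 1..k i. 2 * s i p)"
      using that member_le_sum[of i "{..<m}" "\<lambda>i. \<Sum>p = 1..k i. 2 * s i p"] by simp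
    finally show ?thesis using that by (simp add: N_def)
  qed
  have "\<forall>\<^sub>F n in at_top. real (\<tau> n) / (real n / q * A ^ n) = exp (\<epsilon> n)"
  proof (rule eventually_at_top_linorderI[of N])
    fix n assume n: "N \<le> n"
    then have n0: "0 < n" by (simp add: N_def)
    have "\<forall>i<m. \<forall>p\<in>{1..k i}. real (s i p) \<le> real n / 2" using s_le[OF n] by (force simp: field_simps)
    then have "real (\<tau> n) = real n / q * A ^ n * exp (\<epsilon> n)"
      using assms(7) n0 count s_le[OF n] by simp
    moreover have "real n / q * A ^ n \<noteq> 0"
      using n0 q unfolding assms(10) by simp
    ultimately show "real (\<tau> n) / (real n / q * A ^ n) = exp (\<epsilon> n)"
      by (metis nonzero_mult_div_cancel_left)
  qed
  moreover have "(\<lambda>n. exp (\<epsilon> n)) \<longlonglongrightarrow> 1" using tendsto_exp[OF \<epsilon>] by simp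
  ultimately have "(\<lambda>n. real (\<tau> n) / (real n / q * A ^ n)) \<longlonglongrightarrow> 1"
    by (simp add: tendsto_cong)
  then show ?thesis by (rule asymp_equivI')
qed

end
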